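(* For every $p\in[1,\infty]$, the set $\mathcal{C}_{\mathcal{Q}}$ is dense in the metric space $(\mathcal{C},D_p)$, where $\mathcal{C}_{\mathcal{Q}}$ is the family of all bivariate copulas $C$ for which there exists a Borel set $\Lambda\subseteq[0,1]$ with $\lambda(\Lambda)=1$ such that for every $x\in\Lambda$ there exists a dense set $\mathcal{Q}_x\subset[0,1]$ such that the partial derivative $\partial_1C(x,y)$ does not exist for any $y\in\mathcal{Q}_x$.
   Context: Write $\mathbb{I}=[0,1]$; $\lambda$ and $\lambda_2$ denote Lebesgue measure on $\mathbb{I}$ and $\mathbb{I}^2$. $\mathcal{C}$ is the family of all bivariate copulas (restrictions to $\mathbb{I}^2$ of bivariate distribution functions with uniform marginals on $\mathbb{I}$). For $C\in\mathcal{C}$, $\mu_C$ is the doubly stochastic measure with $\mu_C([0,x]\times[0,y])=C(x,y)$, and $K_C:\mathbb{I}\times\mathcal{B}(\mathbb{I})\to\mathbb{I}$ denotes (a version of) the Markov kernel of $C$, i.e., the regular conditional distribution of $Y$ given $X$ where $(X,Y)\sim C$; equivalently $\mu_C(G)=\int_{\mathbb{I}}K_C(x,G_x)\,d\lambda(x)$ for all Borel $G\subseteq\mathbb{I}^2$, with $G_x=\{y:(x,y)\in G\}$. $\partial_1C$ is the partial derivative of $C$ with respect to its first argument. For $A,B\in\mathcal{C}$ the metrics $D_p$ are $$D_p(A,B)=\left(\int_{\mathbb{I}^2}|K_A(x,[0,y])-K_B(x,[0,y])|^p\,d\lambda_2(x,y)\right)^{1/p},\quad p\in[1,\infty),$$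 $$D_\infty(A,B)=\sup_{y\in\mathbb{I}}\int_{\mathbb{I}}|K_A(x,[0,y])-K_B(x,[0,y])|\,d\lambda(x).$$ *)

theory Defs
  imports "HOL-Probability.Probability"
begin

abbreviation unit_ivl :: "real set" where
  "unit_ivl \<equiv> {0..1}"

abbreviation unit_sq :: "(real \<times> real) set" where
  "unit_sq \<equiv> unit_ivl \<times> unit_ivl"

abbreviation borel_ivl :: "real measure" where
  "borel_ivl \<equiv> restrict_space borel unit_ivl"

abbreviation borel_sq :: "(real \<times> real) measure" where
  "borel_sq \<equiv> restrict_space borel unit_sq"

definition cdf2 :: "(real \<times> real) measure \<Rightarrow> real \<times> real \<Rightarrow> real" where
  "cdf2 M = (\<lambda>(x, y). measure M ({..x} \<times> {..y}))"

text \<open>A copula is a function on the unit square only; it is encoded as a total function that is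
  \<^const>\<open>undefined\<close> outside the square, so that HOL equality of copulas is equality on the square.\<close>

definition copulas :: "(real \<times> real \<Rightarrow> real) set" where
  "copulas = {restrict (cdf2 M) unit_sq |M.
     prob_space M \<and> sets M = sets borel \<and>
     distr M borel fst = uniform_measure lborel unit_ivl \<and>
     distr M borel snd = uniform_measure lborel unit_ivl}"

definition doubly_stochastic :: "(real \<times> real) measure \<Rightarrow> bool" where
  "doubly_stochastic \<mu> \<longleftrightarrow> sets \<mu> = sets borel_sq \<and>
     (\<forall>E \<in> sets borel_ivl. emeasure \<mu> (E \<times> unit_ivl) = emeasure lborel E
                          \<and> emeasure \<mu> (unit_ivl \<times> E) = emeasure lborel E)"

definition copula_measure :: "(real \<times> real \<Rightarrow> real) \<Rightarrow> (real \<times> real) measure" where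
  "copula_measure C = (THE \<mu>. doubly_stochastic \<mu> \<and>
     (\<forall>x \<in> unit_ivl. \<forall>y \<in> unit_ivl. measure \<mu> ({0..x} \<times> {0..y}) = C (x, y)))"

text \<open>\<open>K\<close> is a version of the Markov kernel of \<open>C\<close>; only the values \<open>K x\<close> with \<open>x\<close> in the unit
  interval matter.\<close>

definition is_markov_kernel_of ::
  "(real \<times> real \<Rightarrow> real) \<Rightarrow> (real \<Rightarrow> real measure) \<Rightarrow> bool" where
  "is_markov_kernel_of C K \<longleftrightarrow> K \<in> borel_ivl \<rightarrow>\<^sub>M prob_algebra borel_ivl \<and>
     (\<forall>G \<in> sets borel_sq. emeasure (copula_measure C) G =
        (\<integral>\<^sup>+x\<in>unit_ivl. emeasure (K x) {y. (x, y) \<in> G} \<partial>lborel))"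

text \<open>Versions of the kernel exist by disintegration and agree for almost every \<open>x\<close>, so the metrics
  below do not depend on the choice made here.\<close>

definition markov_kernel :: "(real \<times> real \<Rightarrow> real) \<Rightarrow> real \<Rightarrow> real measure" where
  "markov_kernel C = (SOME K. is_markov_kernel_of C K)"

text \<open>For copulas the integrals under the supremum are at most 1. The supremum is taken
  in \<^typ>\<open>ennreal\<close> only so that \<open>D\<close> is nonnegative for all arguments, as \<^locale>\<open>Metric_space\<close>
  demands even outside the carrier.\<close>

definition D :: "ennreal \<Rightarrow> (real \<times> real \<Rightarrow> real) \<Rightarrow> (real \<times> real \<Rightarrow> real) \<Rightarrow> real" where
  "D p A B =
     (if p = top then
        enn2real (SUP y\<in>unit_ivl. ennreal (LINT x:unit_ivl|lborel.
          \<bar>measure (markov_kernel A x) {0..y} - measure (markov_kernel B x) {0..y}\<bar>))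
      else
        (LINT z:unit_sq|lborel.
          \<bar>measure (markov_kernel A (fst z)) {0..snd z}
             - measure (markov_kernel B (fst z)) {0..snd z}\<bar> powr enn2real p)
        powr (1 / enn2real p))"

text \<open>The derivative is taken within the unit interval, where \<open>C\<close> is defined; for \<open>x\<close> in its
  interior this is the ordinary partial derivative.\<close>

definition has_partial1 :: "(real \<times> real \<Rightarrow> real) \<Rightarrow> real \<Rightarrow> real \<Rightarrow> bool" where
  "has_partial1 C x y \<longleftrightarrow>
     (\<exists>d. ((\<lambda>t. C (t, y)) has_real_derivative d) (at x within unit_ivl))"

definition copulas_Q :: "(real \<times> real \<Rightarrow> real) set" where
  "copulas_Q = {C \<in> copulas.
     \<exists>\<Lambda> \<in> sets borel. \<Lambda> \<subseteq> unit_ivl \<and> emeasure lborel \<Lambda> = 1 \<and>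
       (\<forall>x \<in> \<Lambda>. \<exists>Q \<subseteq> unit_ivl. unit_ivl \<subseteq> closure Q \<and> (\<forall>y \<in> Q. \<not> has_partial1 C x y))}"

end

theory Submission
  imports Defs
begin

text \<open>Given a copula \<open>A\<close>, perturb it to \<open>(1 - \<epsilon>) * A + \<epsilon> * C\<close>, where \<open>C\<close> is a mixture, with positive weights
  \<open>w m\<close>, of the rotations \<open>x \<mapsto> x + r m mod 1\<close> by the rationals \<open>r m\<close> in \<open>[0, 1)\<close>. At \<open>y = x + r m mod 1\<close> the
  left and the right partial derivatives of \<open>C\<close> differ by \<open>w m\<close>, and for each \<open>x\<close> these \<open>y\<close> are dense.
  A kink of \<open>A\<close> at such a point can cancel the one of \<open>\<epsilon> * C\<close> for at most one \<open>\<epsilon>\<close>; so for all but countably many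
  \<open>\<epsilon>\<close> the set of \<open>x\<close> with a cancellation is null, and one can choose \<open>\<epsilon>\<close> arbitrarily small. The perturbation
  moves the values \<open>K x {0..y}\<close> of the Markov kernel by at most \<open>\<epsilon>\<close>.\<close>

section \<open>Disintegration\<close>

text \<open>The given copula \<open>A\<close> need not have one-sided partial derivatives, so kinks
  are not compared through them. They are read off from
  \<open>(f (x + h) + f (x - h) - 2 * f x) / h\<close> along \<open>h = 1 / Suc k\<close>, which is
  linear in \<open>f\<close> and tends to 0 wherever \<open>f\<close> is differentiable. With
  \<open>m\<close> fixed, the limit for \<open>A\<close> at \<open>y = x + r m mod 1\<close> is a
  measurable function of \<open>x\<close> alone. Its law under uniform \<open>x\<close> has at most
  countably many atoms, while the value that cancels the kink of the mixture depends injectively on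
  \<epsilon>. Hence each \<open>m\<close> excludes countably many \<epsilon>, and there are
  countably many \<open>m\<close>. The distances are defined through a kernel picked by
  \<open>SOME\<close>, of which nothing is known until some kernel exists. This is why a
  disintegration is constructed, and why identities between kernels of different copulas can be
  expected only for almost every \<open>x\<close>.\<close>

lemma measure_eqI_quadrants:
  fixes M N :: "(real \<times> real) measure"
  assumes "finite_measure M" and sets: "sets M = sets borel" "sets N = sets borel"
    and eq: "\<And>x y. emeasure M ({..x} \<times> {..y}) = emeasure N ({..x} \<times> {..y})"
  shows "M = N"
proof (rule measure_eqI_generator_eq[where \<Omega>=UNIV and A="\<lambda>n::nat. {..(real n, real n)}"])
  interpret finite_measure M by fact
  have "{..a} \<inter> {..b} = {..inf a b}" for a b :: "real \<times> real" by auto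
  then show "Int_stable (range (\<lambda>a::real \<times> real. {..a}))"
    unfolding Int_stable_def by blast
  show "(\<Union>i. {..(real i, real i)}) = (UNIV :: (real \<times> real) set)"
  proof safe
    fix a b :: real
    obtain n :: nat where "max a b \<le> real n" using real_arch_simple by blast
    then show "(a, b) \<in> (\<Union>i. {..(real i, real i)})" by auto
  qed auto
  show "sets M = sigma_sets UNIV (range (\<lambda>a::real \<times> real. {..a}))"
    "sets N = sigma_sets UNIV (range (\<lambda>a::real \<times> real. {..a}))"
    by (simp_all add: sets borel_eq_atMost)
  show "emeasure M X = emeasure N X" if X: "X \<in> range (\<lambda>a::real \<times> real. {..a})" for X
  proof -
    obtain a b where "X = {..(a, b)}" using X by auto
    then have "X = {..a} \<times> {..b}" by auto
    then show ?thesis using eq by simp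
  qed
qed (auto simp: finite_measure.emeasure_finite[OF assms(1)])

text \<open>Test the hypothesis on the set \<open>E\<close> where the claim fails: there
  \<open>f - g\<close> is positive, yet its integral is 0. Finiteness of the integral of
  \<open>f\<close> makes that of \<open>g\<close> over \<open>E\<close> finite too, as subtraction
  in \<open>ennreal\<close> requires.\<close>

lemma AE_le_if_density_le:
  fixes f g :: "'a \<Rightarrow> ennreal"
  assumes [measurable]: "f \<in> borel_measurable M" "g \<in> borel_measurable M"
    and fin: "(\<integral>\<^sup>+x. f x \<partial>M) \<noteq> \<infinity>"
    and le: "\<And>E. E \<in> sets M \<Longrightarrow> (\<integral>\<^sup>+x. f x * indicator E x \<partial>M) \<le> (\<integral>\<^sup>+x. g x * indicator E x \<partial>M)"
  shows "AE x in M. f x \<le> g x"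
proof -
  define E where "E = {x \<in> space M. g x < f x}"
  have [measurable]: "E \<in> sets M" by (simp add: E_def)
  have gf: "(\<integral>\<^sup>+x. g x * indicator E x \<partial>M) \<le> (\<integral>\<^sup>+x. f x \<partial>M)"
    by (rule nn_integral_mono) (auto simp: E_def indicator_def)
  have "(\<integral>\<^sup>+x. f x * indicator E x - g x * indicator E x \<partial>M)
      = (\<integral>\<^sup>+x. f x * indicator E x \<partial>M) - (\<integral>\<^sup>+x. g x * indicator E x \<partial>M)"
    using gf fin by (intro nn_integral_diff) (auto simp: E_def indicator_def top_unique intro!: AE_I2)
  also have "\<dots> = 0" using le[of E] gf fin by (simp add: diff_eq_0_iff_ennreal less_top top_unique neq_top_trans)
  finally have "AE x in M. f x * indicator E x - g x * indicator E x = 0"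
    by (subst (asm) nn_integral_0_iff_AE) auto
  then show ?thesis
  proof (rule AE_mp, intro AE_I2 impI)
    fix x assume "x \<in> space M" "f x * indicator E x - g x * indicator E x = 0"
    then show "f x \<le> g x"
      by (cases "x \<in> E") (auto simp: E_def not_less dest: ennreal_minus_eq_0)
  qed
qed

text \<open>For fixed \<open>y\<close>, the measure of \<open>E \<times> {..y}\<close> as a function
  of \<open>E\<close> has a Radon-Nikodym density \<open>f y\<close> with respect to the first
  marginal. These densities are monotone in \<open>y\<close> only up to null sets depending on
  \<open>y\<close>, so they are repaired along the rationals. The bound on the second coordinate
  fixes the distribution functions below 0 and from 1 on, so their limits at infinity are
  immediate.\<close>

lemma disintegration:
  fixes M :: "(real \<times> real) measure"
  assumes "prob_space M" and sets[measurable_cong]: "sets M = sets borel"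
    and bdd: "AE z in M. snd z \<in> {0..1}"
  obtains K where "K \<in> borel \<rightarrow>\<^sub>M prob_algebra borel"
    and "\<And>G. G \<in> sets borel \<Longrightarrow>
      emeasure M G = (\<integral>\<^sup>+x. emeasure (K x) {y. (x, y) \<in> G} \<partial>distr M borel fst)"
proof -
  interpret prob_space M by fact
  have [simp]: "space M = UNIV" using sets_eq_imp_space_eq[OF sets] by simp
  have [measurable]: "fst \<in> M \<rightarrow>\<^sub>M borel" "snd \<in> M \<rightarrow>\<^sub>M borel"
    by (simp_all add: measurable_cong_sets[OF sets refl] borel_prod[symmetric])
  define U where "U = distr M borel (fst :: real \<times> real \<Rightarrow> real)"
  have [measurable_cong, simp]: "sets U = sets borel" by (simp add: U_def)
  have [simp]: "space U = UNIV" by (simp add: U_def)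
  interpret U: prob_space U unfolding U_def by (rule prob_space_distr) simp
  have [measurable]: "A \<times> B \<in> sets M" if "A \<in> sets borel" "B \<in> sets borel" for A B :: "real set"
    using that by (simp add: sets borel_prod[symmetric])
  have U_em: "emeasure U E = emeasure M (E \<times> UNIV)" if "E \<in> sets borel" for E
    using that by (auto simp: U_def emeasure_distr intro!: arg_cong[where f="emeasure M"])
  have "\<exists>f\<in>borel_measurable U. \<forall>E\<in>sets borel.
      (\<integral>\<^sup>+x. f x * indicator E x \<partial>U) = emeasure M (E \<times> {..y})" for y :: real
  proof -
    define N where "N = distr (density M (indicator (UNIV \<times> {..y}))) borel (fst :: real \<times> real \<Rightarrow> real)"
    have N_em: "emeasure N E = emeasure M (E \<times> {..y})" if "E \<in> sets borel" for E
    proof -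
      have "emeasure N E = emeasure (density M (indicator (UNIV \<times> {..y}))) (E \<times> UNIV)"
        using that by (auto simp: N_def emeasure_distr intro!: arg_cong[where f="emeasure _"])
      also have "\<dots> = (\<integral>\<^sup>+z. indicator (UNIV \<times> {..y}) z * indicator (E \<times> UNIV) z \<partial>M)"
        using that by (subst emeasure_density) auto
      also have "\<dots> = (\<integral>\<^sup>+z. indicator (E \<times> {..y}) z \<partial>M)"
        by (intro nn_integral_cong) (auto simp: indicator_def)
      finally show ?thesis using that by simp
    qed
    have ac: "absolutely_continuous U N"
    proof (unfold absolutely_continuous_def, safe)
      fix E assume "E \<in> null_sets U"
      then have E: "E \<in> sets borel" "emeasure M (E \<times> UNIV) = 0" by (auto simp: null_sets_def U_em)
      have "emeasure M (E \<times> {..y}) \<le> emeasure M (E \<times> UNIV)" using E by (intro emeasure_mono) auto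
      then show "E \<in> null_sets N" using E by (auto simp: null_sets_def N_em) (simp add: N_def)
    qed
    obtain f where f: "f \<in> borel_measurable U" "density U f = N"
      using U.Radon_Nikodym[OF ac] by (auto simp: N_def)
    have "(\<integral>\<^sup>+x. f x * indicator E x \<partial>U) = emeasure M (E \<times> {..y})" if "E \<in> sets borel" for E
      using f that N_em[OF that] emeasure_density[of f U E] by simp
    then show ?thesis using f by auto
  qed
  then obtain f where fm: "\<And>y. f y \<in> borel_measurable U"
    and f: "\<And>y E. E \<in> sets borel \<Longrightarrow> (\<integral>\<^sup>+x. f y x * indicator E x \<partial>U) = emeasure M (E \<times> {..y::real})"
    by metis
  note fm[measurable]
  have f_mono: "AE x in U. f y x \<le> f z x" if "y \<le> z" for y z
  proof (rule AE_le_if_density_le)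
    show "(\<integral>\<^sup>+x. f y x \<partial>U) \<noteq> \<infinity>" using f[of UNIV y] by (simp add: emeasure_finite)
    show "(\<integral>\<^sup>+x. f y x * indicator E x \<partial>U) \<le> (\<integral>\<^sup>+x. f z x * indicator E x \<partial>U)" if "E \<in> sets U" for E
      using that \<open>y \<le> z\<close> by (simp add: f) (intro emeasure_mono, auto)
  qed auto
  have f_le1: "AE x in U. f y x \<le> 1" for y
  proof (rule AE_le_if_density_le)
    show "(\<integral>\<^sup>+x. f y x \<partial>U) \<noteq> \<infinity>" using f[of UNIV y] by (simp add: emeasure_finite)
    show "(\<integral>\<^sup>+x. f y x * indicator E x \<partial>U) \<le> (\<integral>\<^sup>+x. 1 * indicator E x \<partial>U)" if "E \<in> sets U" for E
      using that by (simp add: f U_em) (intro emeasure_mono, auto)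
  qed auto
  have f0: "AE x in U. f y x = 0" if "y < 0" for y
  proof -
    have "AE z in M. z \<notin> UNIV \<times> {..y}" using bdd by eventually_elim (use that in auto)
    then have "emeasure M (UNIV \<times> {..y}) = 0" by (subst (asm) AE_iff_measurable[OF _ refl]) auto
    then have "(\<integral>\<^sup>+x. f y x \<partial>U) = 0" using f[of UNIV y] by simp
    then show ?thesis by (subst (asm) nn_integral_0_iff_AE) auto
  qed
  have f1: "AE x in U. f y x \<ge> 1" if "y \<ge> 1" for y
  proof (rule AE_le_if_density_le)
    show "(\<integral>\<^sup>+x. 1 \<partial>U) \<noteq> \<infinity>" by (simp add: U.emeasure_space_1[simplified])
    fix E assume E: "E \<in> sets U"
    have "emeasure M (E \<times> UNIV) = emeasure M (E \<times> {..y})"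
    proof (rule emeasure_eq_AE)
      show "AE z in M. z \<in> E \<times> UNIV \<longleftrightarrow> z \<in> E \<times> {..y}"
        using bdd by eventually_elim (use that in auto)
    qed (use E in auto)
    then show "(\<integral>\<^sup>+x. 1 * indicator E x \<partial>U) \<le> (\<integral>\<^sup>+x. f y x * indicator E x \<partial>U)"
      using E by (simp add: f U_em)
  qed auto
  \<comment> \<open>Clamping changes \<open>f q\<close> only on a null set, but gives the exact
    tails and the bound 1 at every \<open>x\<close>.\<close>
  define g :: "real \<Rightarrow> real \<Rightarrow> ennreal"
    where "g q x = (if q < 0 then 0 else if q \<ge> 1 then 1 else min 1 (f q x))" for q x
  have [measurable]: "g q \<in> borel_measurable U" for q unfolding g_def by measurable
  have gf: "AE x in U. g q x = f q x" for q
  proof -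
    consider "q < 0" | "q \<ge> 1" | "0 \<le> q" "q < 1" by linarith
    then show ?thesis
    proof cases
      case 1 show ?thesis using f0[OF 1] by eventually_elim (use 1 in \<open>simp add: g_def\<close>)
    next
      case 2 show ?thesis using f1[OF 2] f_le1[of q] by eventually_elim (use 2 in \<open>simp add: g_def\<close>)
    next
      case 3 show ?thesis using f_le1[of q] by eventually_elim (use 3 in \<open>simp add: g_def\<close>)
    qed
  qed
  text \<open>Taking the supremum over smaller and the infimum over larger rationals yields a right-continuous
    distribution function for every \<open>x\<close>, not only almost everywhere.\<close>
  define h where "h q x = (SUP r\<in>{r\<in>\<rat>. r \<le> q}. g r x)" for q x
  define F where "F y x = (INF q\<in>{q\<in>\<rat>. y < q}. h q x)" for y x
  have cnt: "countable {r\<in>\<rat>. r \<le> q}" "countable {r\<in>\<rat>. q < r}" for q :: real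
    by (auto intro: countable_subset[OF _ countable_rat])
  have [measurable]: "h q \<in> borel_measurable U" for q
    unfolding h_def using cnt by (intro borel_measurable_SUP) auto
  have [measurable]: "F y \<in> borel_measurable U" for y
    unfolding F_def using cnt by (intro borel_measurable_INF) auto
  have h_le1: "h q x \<le> 1" for q x
    unfolding h_def by (intro SUP_least) (auto simp: g_def)
  have h_mono: "h q x \<le> h q' x" if "q \<le> q'" for q q' x
    unfolding h_def using that by (intro SUP_subset_mono) auto
  have hf: "AE x in U. h q x = f q x" if "q \<in> \<rat>" for q
  proof -
    have "AE x in U. \<forall>r\<in>{r\<in>\<rat>. r \<le> q}. g r x = f r x \<and> f r x \<le> f q x"
      using cnt gf f_mono by (subst AE_ball_countable) auto
    then show ?thesis
    proof eventually_elim
      case (elim x)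
      then show ?case unfolding h_def using that
        by (intro antisym SUP_least SUP_upper2[of q]) auto
    qed
  qed
  have F_le: "F y x \<le> h q x" if "y < q" "q \<in> \<rat>" for y q x
    unfolding F_def using that by (intro INF_lower) auto
  have F_mono: "F y x \<le> F z x" if "y \<le> z" for y z x
    unfolding F_def using that by (intro INF_superset_mono) auto
  have F0: "F y x = 0" if "y < 0" for y x
  proof -
    obtain q where q: "q \<in> \<rat>" "y < q" "q < 0" using Rats_dense_in_real[OF \<open>y < 0\<close>] by auto
    have "h q x \<le> 0" unfolding h_def by (rule SUP_least) (use q in \<open>auto simp: g_def\<close>)
    with F_le[OF q(2,1), of x] show ?thesis by simp
  qed
  have F_le1: "F y x \<le> 1" for y x
  proof -
    obtain q where q: "q \<in> \<rat>" "y < q" using Rats_dense_in_real[of y "y+1"] by auto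
    show ?thesis using F_le[OF q(2,1), of x] h_le1[of q x] by simp
  qed
  have F1: "F y x = 1" if "y \<ge> 1" for y x
  proof (rule antisym[OF F_le1])
    show "1 \<le> F y x" unfolding F_def
    proof (rule INF_greatest)
      fix q :: real assume "q \<in> {q \<in> \<rat>. y < q}"
      then show "1 \<le> h q x" unfolding h_def using that by (intro SUP_upper2[of q]) (auto simp: g_def)
    qed
  qed
  \<comment> \<open>One inequality is pointwise almost everywhere: \<open>f y\<close> lies below all
    the countably many \<open>h q\<close> with \<open>q > y\<close>. The other is obtained only
    after integration, from rationals \<open>q n\<close> tending to \<open>y\<close> and continuity
    of \<open>M\<close> from above.\<close>
  have FM: "(\<integral>\<^sup>+x. F y x * indicator E x \<partial>U) = emeasure M (E \<times> {..y})" if E: "E \<in> sets borel" for y E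
  proof (rule antisym)
    have "AE x in U. \<forall>q\<in>{q\<in>\<rat>. y < q}. f y x \<le> h q x"
    proof (subst AE_ball_countable, safe)
      fix q :: real assume "q \<in> \<rat>" "y < q"
      then show "AE x in U. f y x \<le> h q x"
        using hf[of q] f_mono[of y q] by auto
    qed (use cnt in auto)
    then have "AE x in U. f y x \<le> F y x"
      unfolding F_def by eventually_elim (auto intro: INF_greatest)
    then show "emeasure M (E \<times> {..y}) \<le> (\<integral>\<^sup>+x. F y x * indicator E x \<partial>U)"
      unfolding f[OF E, symmetric] by (intro nn_integral_mono_AE) (auto elim!: eventually_mono intro: mult_right_mono)
    have "\<exists>q\<in>\<rat>. y < q \<and> q < y + 1 / Suc n" for n
      by (rule Rats_dense_in_real) simp
    then obtain q where q: "\<And>n. q n \<in> \<rat>" "\<And>n. y < q n" "\<And>n. q n < y + 1 / Suc n" by metis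
    have "(\<integral>\<^sup>+x. F y x * indicator E x \<partial>U) \<le> emeasure M (E \<times> {..y + 1 / Suc n})" for n
    proof -
      have "(\<integral>\<^sup>+x. F y x * indicator E x \<partial>U) \<le> (\<integral>\<^sup>+x. f (q n) x * indicator E x \<partial>U)"
        using hf[OF q(1)[of n]]
        by (intro nn_integral_mono_AE, eventually_elim) (metis F_le q(1) q(2) mult_right_mono zero_le)
      also have "\<dots> = emeasure M (E \<times> {..q n})" using f E by auto
      also have "\<dots> \<le> emeasure M (E \<times> {..y + 1 / Suc n})"
        using E q(3)[of n] by (intro emeasure_mono) auto
      finally show ?thesis .
    qed
    then have "(\<integral>\<^sup>+x. F y x * indicator E x \<partial>U) \<le> (INF n. emeasure M (E \<times> {..y + 1 / Suc n}))"
      by (intro INF_greatest) auto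
    also have "\<dots> = emeasure M (\<Inter>n. E \<times> {..y + 1 / Suc n})"
    proof (rule INF_emeasure_decseq)
      show "decseq (\<lambda>n. E \<times> {..y + 1 / real (Suc n)})"
        by (auto simp: decseq_def frac_le intro: order_trans)
    qed (use E in \<open>auto simp: emeasure_finite\<close>)
    also have "(\<Inter>n. E \<times> {..y + 1 / real (Suc n)}) = E \<times> {..y}"
    proof -
      have "z \<le> y" if "\<And>n. z \<le> y + 1 / real (Suc n)" for z
      proof (rule field_le_epsilon)
        fix e :: real assume "0 < e"
        then obtain n where "1 / real (Suc n) < e" using nat_approx_posE by blast
        then show "z \<le> y + e" using that[of n] by linarith
      qed
      then show ?thesis by (auto intro: add_increasing2)
    qed
    finally show "(\<integral>\<^sup>+x. F y x * indicator E x \<partial>U) \<le> emeasure M (E \<times> {..y})" .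
  qed
  define K where "K x = interval_measure (\<lambda>y. enn2real (F y x))" for x
  have Fr_mono: "enn2real (F y x) \<le> enn2real (F z x)" if "y \<le> z" for y z x
    using F_mono[OF that] F_le1[of z x] by (intro enn2real_mono) (auto simp: le_less_trans)
  have Fr_cont: "continuous (at_right y) (\<lambda>y. enn2real (F y x))" for y x
  proof (subst continuous_at_right_real_increasing)
    show "\<forall>e>0. \<exists>d>0. enn2real (F (y + d) x) - enn2real (F y x) < e"
    proof safe
      fix e :: real assume e: "e > 0"
      have "F y x < F y x + ennreal e"
        using e F_le1[of y x] by (cases "F y x") (auto simp flip: ennreal_plus simp: ennreal_less_iff top_unique)
      then obtain q where q: "q \<in> \<rat>" "y < q" "h q x < F y x + ennreal e"
        unfolding F_def by (auto simp: INF_less_iff)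
      have "F (y + (q - y) / 2) x \<le> h q x" using q by (intro F_le) (auto simp: field_simps)
      then have "F (y + (q - y) / 2) x < F y x + ennreal e" using q by auto
      moreover have "F (y + (q - y) / 2) x = ennreal (enn2real (F (y + (q - y) / 2) x))"
        "F y x = ennreal (enn2real (F y x))"
        using F_le1 by (auto simp: less_top[symmetric] top_unique neq_top_trans[of 1])
      ultimately have "enn2real (F (y + (q - y) / 2) x) < enn2real (F y x) + e"
        using e by (metis ennreal_less_iff ennreal_plus enn2real_nonneg less_imp_le)
      then show "\<exists>d>0. enn2real (F (y + d) x) - enn2real (F y x) < e"
        using q by (intro exI[of _ "(q - y) / 2"]) auto
    qed
  qed (fact Fr_mono)
  have Fr_bot: "((\<lambda>y. enn2real (F y x)) \<longlongrightarrow> 0) at_bot" for x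
    by (rule tendsto_eventually) (use F0 in \<open>auto simp: eventually_at_bot_dense intro!: exI[of _ 0]\<close>)
  have Fr_top: "((\<lambda>y. enn2real (F y x)) \<longlongrightarrow> 1) at_top" for x
    by (rule tendsto_eventually) (use F1 in \<open>auto simp: eventually_at_top_linorder intro!: exI[of _ 1]\<close>)
  have K_real: "real_distribution (K x)" for x
    unfolding K_def by (rule real_distribution_interval_measure[OF Fr_mono Fr_cont Fr_bot Fr_top])
  have K_em: "emeasure (K x) {..y} = F y x" for x y
  proof -
    interpret K: real_distribution "K x" by (rule K_real)
    have "measure (K x) {..y} = enn2real (F y x)"
      unfolding K_def by (rule measure_interval_measure_Iic[OF Fr_mono Fr_cont Fr_bot])
    then show ?thesis
      using F_le1[of y x] by (simp add: K.emeasure_eq_measure less_top[symmetric] neq_top_trans[of 1])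
  qed
  have K[measurable]: "K \<in> borel \<rightarrow>\<^sub>M prob_algebra borel"
  proof (rule measurable_prob_algebra_generated)
    show "sets borel = sigma_sets UNIV (range (\<lambda>a::real. {..a}))" by (simp add: borel_eq_atMost)
    show "Int_stable (range (\<lambda>a::real. {..a}))" by (auto simp: Int_stable_def)
    show "(\<lambda>x. emeasure (K x) A) \<in> borel_measurable borel" if A: "A \<in> range (\<lambda>a::real. {..a})" for A
      using A by (auto simp: K_em)
  qed (use K_real in \<open>auto simp: real_distribution_def real_distribution_axioms_def\<close>)
  \<comment> \<open>The law rebuilt from the marginal and the kernel. It satisfies the
    disintegration formula by construction, and \<open>FM\<close> identifies it with
    \<open>M\<close> on quadrants.\<close>
  define N where "N = U \<bind> (\<lambda>x. distr (K x) borel (Pair x))"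
  have U_in: "U \<in> space (prob_algebra borel)" by (simp add: space_prob_algebra U.prob_space_axioms)
  have Pm[measurable]: "(\<lambda>x. distr (K x) borel (Pair x)) \<in> borel \<rightarrow>\<^sub>M prob_algebra borel"
    by (rule measurable_distr_prob_space2[OF K]) (simp add: borel_prod[symmetric])
  have N_em: "emeasure N G = (\<integral>\<^sup>+x. emeasure (K x) {y. (x, y) \<in> G} \<partial>U)" if G: "G \<in> sets borel" for G
  proof -
    have "emeasure N G = (\<integral>\<^sup>+x. emeasure (distr (K x) borel (Pair x)) G \<partial>U)"
      unfolding N_def using U_in Pm G by (rule emeasure_bind_prob_algebra)
    also have "\<dots> = (\<integral>\<^sup>+x. emeasure (K x) {y. (x, y) \<in> G} \<partial>U)"
    proof (rule nn_integral_cong)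
      fix x
      interpret K: real_distribution "K x" by (rule K_real)
      have "Pair x \<in> K x \<rightarrow>\<^sub>M borel" by (simp add: borel_prod[symmetric])
      then show "emeasure (distr (K x) borel (Pair x)) G = emeasure (K x) {y. (x, y) \<in> G}"
        using G by (subst emeasure_distr) (auto simp: vimage_def)
    qed
    finally show ?thesis .
  qed
  have "M = N"
  proof (rule measure_eqI_quadrants)
    show "finite_measure M" by unfold_locales
    show "sets N = sets borel" unfolding N_def by (rule sets_bind) (auto)
    fix x y
    have "emeasure N ({..x} \<times> {..y}) = (\<integral>\<^sup>+u. emeasure (K u) {v. (u, v) \<in> {..x} \<times> {..y}} \<partial>U)"
      by (rule N_em) (simp add: borel_prod[symmetric])
    also have "\<dots> = (\<integral>\<^sup>+u. F y u * indicator {..x} u \<partial>U)"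
      by (rule nn_integral_cong) (auto simp: indicator_def K_em[symmetric] atMost_def)
    also have "\<dots> = emeasure M ({..x} \<times> {..y})" by (rule FM) simp
    finally show "emeasure M ({..x} \<times> {..y}) = emeasure N ({..x} \<times> {..y})" ..
  qed (fact sets)
  show thesis
  proof (rule that[OF K])
    fix G :: "(real \<times> real) set" assume G: "G \<in> sets borel"
    show "emeasure M G = (\<integral>\<^sup>+x. emeasure (K x) {y. (x, y) \<in> G} \<partial>distr M borel fst)"
      unfolding U_def[symmetric] N_em[OF G, symmetric] by (rule arg_cong[OF \<open>M = N\<close>])
  qed
qed

section \<open>Copulas and their Markov kernels\<close>

abbreviation unif :: "real measure" where
  "unif \<equiv> uniform_measure lborel unit_ivl"

lemma prob_space_unif: "prob_space unif"
  by (rule prob_space_uniform_measure) auto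

lemma emeasure_unif: "E \<in> sets borel \<Longrightarrow> emeasure unif E = emeasure lborel (unit_ivl \<inter> E)"
  by (simp add: divide_ennreal_def)

lemma nn_integral_unif:
  "f \<in> borel_measurable borel \<Longrightarrow> (\<integral>\<^sup>+x. f x \<partial>unif) = (\<integral>\<^sup>+x\<in>unit_ivl. f x \<partial>lborel)"
  by (simp add: nn_integral_uniform_measure divide_ennreal_def)

text \<open>These laws live on the whole plane, so marginals, distribution functions and
  pushforwards avoid restricted spaces; \<open>AE_unit_sq\<close> leads back to the square.\<close>

locale copula_law = prob_space M for M :: "(real \<times> real) measure" +
  assumes sets_M[measurable_cong]: "sets M = sets borel"
    and distr_fst: "distr M borel fst = unif"
    and distr_snd: "distr M borel snd = unif"

lemma copulas_eq: "copulas = {restrict (cdf2 M) unit_sq |M. copula_law M}"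
  by (simp add: copulas_def copula_law_def copula_law_axioms_def)

lemma Times_borel: "A \<in> sets borel \<Longrightarrow> B \<in> sets borel \<Longrightarrow> A \<times> B \<in> sets (borel :: (real \<times> real) measure)"
  by (simp add: borel_prod[symmetric])

context copula_law
begin

lemma space_M[simp]: "space M = UNIV"
  using sets_eq_imp_space_eq[OF sets_M] by simp

lemma proj_measurable[measurable]: "fst \<in> M \<rightarrow>\<^sub>M borel" "snd \<in> M \<rightarrow>\<^sub>M borel"
  by (simp_all add: measurable_cong_sets[OF sets_M refl] borel_prod[symmetric])

lemma Times_sets[measurable]: "A \<in> sets borel \<Longrightarrow> B \<in> sets borel \<Longrightarrow> A \<times> B \<in> sets M"
  by (simp add: sets_M Times_borel)

lemma emeasure_fst: "E \<in> sets borel \<Longrightarrow> emeasure M (E \<times> UNIV) = emeasure lborel (unit_ivl \<inter> E)"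
  using emeasure_distr[of fst M borel E] by (simp add: distr_fst divide_ennreal_def vimage_fst)

lemma emeasure_snd: "E \<in> sets borel \<Longrightarrow> emeasure M (UNIV \<times> E) = emeasure lborel (unit_ivl \<inter> E)"
  using emeasure_distr[of snd M borel E] by (simp add: distr_snd divide_ennreal_def vimage_snd)

lemma AE_unit_sq: "AE z in M. z \<in> unit_sq"
proof -
  have "AE x in distr M borel fst. x \<in> unit_ivl" "AE x in distr M borel snd. x \<in> unit_ivl"
    unfolding distr_fst distr_snd by (auto intro!: AE_uniform_measureI)
  then have "AE z in M. fst z \<in> unit_ivl" "AE z in M. snd z \<in> unit_ivl"
    by (auto simp: AE_distr_iff)
  then show ?thesis by eventually_elim (auto simp: mem_Times_iff)
qed

text \<open>This resolves the \<open>THE\<close>. The restriction qualifies because \<open>M\<close>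
  is concentrated on the square; any other candidate has the same masses on quadrants once both are
  extended to the plane.\<close>

lemma copula_measure_eq: "copula_measure (restrict (cdf2 M) unit_sq) = restrict_space M unit_sq"
  unfolding copula_measure_def
proof (rule the_equality)
  let ?R = "restrict_space M unit_sq"
  have sq: "unit_sq \<in> sets M" by simp
  have em: "emeasure ?R X = emeasure M X" if "X \<subseteq> unit_sq" for X
    using that sq by (simp add: emeasure_restrict_space)
  have "doubly_stochastic ?R"
    unfolding doubly_stochastic_def
  proof (intro conjI ballI)
    show "sets ?R = sets borel_sq" by (simp add: sets_restrict_space sets_M)
    fix E assume "E \<in> sets borel_ivl"
    then have E: "E \<in> sets borel" "E \<subseteq> unit_ivl" by (auto simp: sets_restrict_space_iff)
    have "emeasure M (E \<times> unit_ivl) = emeasure M (E \<times> UNIV)"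
      "emeasure M (unit_ivl \<times> E) = emeasure M (UNIV \<times> E)"
      using E AE_unit_sq by (auto intro!: emeasure_eq_AE elim!: eventually_mono)
    then show "emeasure ?R (E \<times> unit_ivl) = emeasure lborel E"
      "emeasure ?R (unit_ivl \<times> E) = emeasure lborel E"
      using E by (auto simp: em Sigma_mono emeasure_fst emeasure_snd Int_absorb1)
  qed
  moreover have "measure ?R ({0..x} \<times> {0..y}) = restrict (cdf2 M) unit_sq (x, y)"
    if "x \<in> unit_ivl" "y \<in> unit_ivl" for x y
  proof -
    have "measure ?R ({0..x} \<times> {0..y}) = measure M ({0..x} \<times> {0..y})"
      using that by (intro measure_restrict_space) auto
    also have "\<dots> = measure M ({..x} \<times> {..y})"
      using AE_unit_sq by (intro finite_measure_eq_AE) (auto elim!: eventually_mono)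
    finally show ?thesis using that by (simp add: cdf2_def)
  qed
  ultimately show *: "doubly_stochastic ?R \<and> (\<forall>x\<in>unit_ivl. \<forall>y\<in>unit_ivl.
      measure ?R ({0..x} \<times> {0..y}) = restrict (cdf2 M) unit_sq (x, y))" by blast
  fix \<mu> assume \<mu>: "doubly_stochastic \<mu> \<and> (\<forall>x\<in>unit_ivl. \<forall>y\<in>unit_ivl.
      measure \<mu> ({0..x} \<times> {0..y}) = restrict (cdf2 M) unit_sq (x, y))"
  have sets: "sets N = sets borel_sq" "space N = unit_sq" "emeasure N unit_sq = 1" if "doubly_stochastic N" for N
  proof -
    show "sets N = sets borel_sq" using that by (simp add: doubly_stochastic_def)
    then show "space N = unit_sq" by (simp add: sets_eq_imp_space_eq[of N borel_sq] space_restrict_space)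
    have "unit_ivl \<in> sets borel_ivl" by (simp add: sets_restrict_space_iff)
    with that show "emeasure N unit_sq = 1" by (auto simp: doubly_stochastic_def)
  qed
  \<comment> \<open>Pushing forward along \<open>id\<close> extends a measure on the square to the
    plane, where \<open>measure_eqI_quadrants\<close> applies.\<close>
  have id: "id \<in> N \<rightarrow>\<^sub>M borel" if "doubly_stochastic N" for N
    using sets(1)[OF that] by (simp add: measurable_cong_sets[of N borel_sq] id_def measurable_restrict_space1)
  have cdf: "emeasure (distr N borel id) ({..x} \<times> {..y})
      = (if x < 0 \<or> y < 0 then 0 else emeasure N ({0..min x 1} \<times> {0..min y 1}))"
    if "doubly_stochastic N" for N x y
  proof -
    have "emeasure (distr N borel id) ({..x} \<times> {..y}) = emeasure N (({..x} \<times> {..y}) \<inter> unit_sq)"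
      using id[OF that] sets(2)[OF that] by (subst emeasure_distr) (simp_all add: Times_borel)
    moreover have "({..x} \<times> {..y}) \<inter> unit_sq
        = (if x < 0 \<or> y < 0 then {} else {0..min x 1} \<times> {0..min y 1})"
      by auto
    ultimately show ?thesis by simp
  qed
  have "distr \<mu> borel id = distr ?R borel id"
  proof (rule measure_eqI_quadrants)
    have "prob_space \<mu>" using \<mu> sets by (intro prob_spaceI) auto
    then interpret \<mu>: prob_space \<mu> .
    have "prob_space ?R" using * sets by (intro prob_spaceI) auto
    then interpret R: prob_space ?R .
    show "finite_measure (distr \<mu> borel id)"
      using \<mu> id by (intro \<mu>.finite_measure_distr) auto
    show "emeasure (distr \<mu> borel id) ({..x} \<times> {..y}) = emeasure (distr ?R borel id) ({..x} \<times> {..y})" for x y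
      using \<mu> * by (auto simp: cdf \<mu>.emeasure_eq_measure R.emeasure_eq_measure)
  qed auto
  show "\<mu> = ?R"
  proof (rule measure_eqI)
    show "sets \<mu> = sets ?R" using \<mu> * sets by simp
    fix G assume "G \<in> sets \<mu>"
    then have G: "G \<in> sets borel" "G \<subseteq> unit_sq"
      using \<mu> sets(1)[of \<mu>] by (auto simp: sets_restrict_space_iff Times_borel)
    have "emeasure (distr N borel id) G = emeasure N G" if "doubly_stochastic N" for N
      using id[OF that] sets(2)[OF that] G by (simp add: emeasure_distr Int_absorb2)
    then show "emeasure \<mu> G = emeasure ?R G" using \<mu> * \<open>distr \<mu> borel id = distr ?R borel id\<close> by metis
  qed
qed

text \<open>The kernel of \<open>disintegration\<close> lives on the real line and may charge points
  outside the unit interval for exceptional \<open>x\<close>. Pushing it forward along the clamping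
  map \<open>c\<close> gives a probability on the interval for every \<open>x\<close>; the integrals
  survive because \<open>c\<close> fixes the interval.\<close>

lemma markov_kernel_exists: "\<exists>K. is_markov_kernel_of (restrict (cdf2 M) unit_sq) K"
proof -
  have "AE z in M. snd z \<in> {0..1}" using AE_unit_sq by eventually_elim (auto simp: mem_Times_iff)
  then obtain K where K[measurable]: "K \<in> borel \<rightarrow>\<^sub>M prob_algebra borel"
    and K_em: "\<And>G. G \<in> sets borel \<Longrightarrow>
      emeasure M G = (\<integral>\<^sup>+x. emeasure (K x) {y. (x, y) \<in> G} \<partial>distr M borel fst)"
    by (rule disintegration[OF prob_space_axioms sets_M]) (rule that)
  note K_em = K_em[unfolded distr_fst]
  define c :: "real \<Rightarrow> real" where "c y = max 0 (min 1 y)" for y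
  have c[measurable]: "c \<in> borel \<rightarrow>\<^sub>M borel_ivl"
    by (auto intro!: measurable_restrict_space2 simp: c_def[abs_def])
  have c_id: "c y = y" if "y \<in> unit_ivl" for y using that by (auto simp: c_def)
  define K' where "K' x = distr (K x) borel_ivl c" for x
  have "K' \<in> borel \<rightarrow>\<^sub>M prob_algebra borel_ivl" unfolding K'_def by measurable
  then have "K' \<in> borel_ivl \<rightarrow>\<^sub>M prob_algebra borel_ivl" by (rule measurable_restrict_space1)
  moreover have "emeasure (restrict_space M unit_sq) G = (\<integral>\<^sup>+x\<in>unit_ivl. emeasure (K' x) {y. (x, y) \<in> G} \<partial>lborel)"
    if "G \<in> sets borel_sq" for G
  proof -
    have G: "G \<in> sets borel" "G \<subseteq> unit_sq" using that by (auto simp: sets_restrict_space_iff Times_borel)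
    \<comment> \<open>\<open>G\<close> and \<open>H\<close> agree on the square, so \<open>M\<close>
      gives them equal mass, and the sections of \<open>H\<close> are the preimages under
      \<open>c\<close> of those of \<open>G\<close>.\<close>
    define H where "H = (\<lambda>(x, y). (x, c y)) -` G"
    have "(\<lambda>(x, y). (x, c y)) \<in> borel \<Otimes>\<^sub>M borel \<rightarrow>\<^sub>M borel \<Otimes>\<^sub>M borel"
      unfolding c_def by measurable
    from measurable_sets[OF this, of G] have H: "H \<in> sets borel"
      using G(1) by (simp only: H_def borel_prod space_borel Int_UNIV_right)
    have "emeasure (restrict_space M unit_sq) G = emeasure M G"
      using G by (simp add: emeasure_restrict_space)
    also have "\<dots> = emeasure M H"
      using AE_unit_sq G H c_id by (intro emeasure_eq_AE) (auto simp: sets_M H_def elim!: eventually_mono)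
    also have "\<dots> = (\<integral>\<^sup>+x. emeasure (K x) {y. (x, y) \<in> H} \<partial>unif)" by (rule K_em[OF H])
    also have "\<dots> = (\<integral>\<^sup>+x\<in>unit_ivl. emeasure (K x) {y. (x, y) \<in> H} \<partial>lborel)"
    proof (rule nn_integral_unif)
      have "Sigma (space borel) (\<lambda>x. {y. (x, y) \<in> H}) = H" by auto
      then show "(\<lambda>x. emeasure (K x) {y. (x, y) \<in> H}) \<in> borel_measurable borel"
        using H by (intro emeasure_measurable_subprob_algebra2[where N=borel] measurable_prob_algebraD[OF K])
          (simp only: borel_prod)
    qed
    also have "\<dots> = (\<integral>\<^sup>+x\<in>unit_ivl. emeasure (K' x) {y. (x, y) \<in> G} \<partial>lborel)"
    proof (intro nn_integral_cong arg_cong2[where f="(*)"] refl)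
      fix x
      have Kx: "sets (K x) = sets borel" using measurable_space[OF K, of x] by (simp add: space_prob_algebra)
      have "c \<in> K x \<rightarrow>\<^sub>M borel_ivl" using c unfolding measurable_cong_sets[OF Kx refl] .
      moreover have "Pair x -` G \<in> sets borel" using G(1) by (intro sets_Pair1[where ?M1.0=borel]) (simp only: borel_prod)
      then have "{y. (x, y) \<in> G} \<in> sets borel_ivl" using G(2) by (auto simp: sets_restrict_space_iff vimage_def)
      ultimately show "emeasure (K x) {y. (x, y) \<in> H} = emeasure (K' x) {y. (x, y) \<in> G}"
        unfolding K'_def using sets_eq_imp_space_eq[OF Kx]
        by (subst emeasure_distr) (auto simp: H_def intro!: arg_cong[where f="emeasure (K x)"])
    qed
    finally show ?thesis .
  qed
  ultimately show ?thesis unfolding is_markov_kernel_of_def copula_measure_eq by blast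
qed

end

text \<open>The value 0 off the square turns the set integrals in \<open>D\<close> into integrals
  over the whole space and makes the function Borel on the whole plane.\<close>

definition kcdf :: "(real \<times> real \<Rightarrow> real) \<Rightarrow> real \<Rightarrow> real \<Rightarrow> real" where
  "kcdf C x y = (if x \<in> unit_ivl \<and> y \<in> unit_ivl then measure (markov_kernel C x) {0..y} else 0)"

context
  fixes C assumes C: "C \<in> copulas"
begin

lemma markov_kernel: "is_markov_kernel_of C (markov_kernel C)"
  using C copula_law.markov_kernel_exists someI_ex[of "is_markov_kernel_of C"]
  unfolding markov_kernel_def copulas_eq by blast

lemma markov_kernel_measurable: "markov_kernel C \<in> borel_ivl \<rightarrow>\<^sub>M prob_algebra borel_ivl"
  using markov_kernel by (simp add: is_markov_kernel_of_def)

lemma kcdf_nonneg: "0 \<le> kcdf C x y" by (simp add: kcdf_def)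

lemma markov_kernel_prob:
  assumes "x \<in> unit_ivl"
  shows "prob_space (markov_kernel C x)" "sets (markov_kernel C x) = sets borel_ivl"
  using measurable_space[OF markov_kernel_measurable, of x] assms
  by (auto simp: space_prob_algebra space_restrict_space)

lemma kcdf_le_1: "kcdf C x y \<le> 1"
  by (auto simp: kcdf_def intro!: prob_space.prob_le_1 markov_kernel_prob)

text \<open>The set \<open>{0..y}\<close> moves with the point, so measurability of the kernel on a
  fixed set does not suffice; it is treated as a section of a measurable region in a product space.
  Joint measurability is what Fubini arguments on the square require.\<close>

lemma kcdf_borel_measurable: "(\<lambda>z. kcdf C (fst z) (snd z)) \<in> borel_measurable borel"
proof -
  have fst: "fst \<in> borel_sq \<rightarrow>\<^sub>M borel_ivl"
    by (rule measurable_restrict_space2, force simp: space_restrict_space, rule measurable_restrict_space1)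
       (simp add: borel_prod[symmetric])
  have snd: "snd \<in> borel_measurable borel_sq"
    by (auto intro!: measurable_restrict_space1 simp: borel_prod[symmetric])
  have id: "(\<lambda>y. y) \<in> borel_measurable borel_ivl" by (rule measurable_restrict_space1) simp
  have "{w \<in> space (borel_sq \<Otimes>\<^sub>M borel_ivl). snd w \<le> snd (fst w)} \<in> sets (borel_sq \<Otimes>\<^sub>M borel_ivl)"
    by (rule borel_measurable_le measurable_compose[OF measurable_snd id] measurable_compose[OF measurable_fst snd])+
  also have "{w \<in> space (borel_sq \<Otimes>\<^sub>M borel_ivl). snd w \<le> snd (fst w)} = Sigma (space borel_sq) (\<lambda>z. {0..snd z})"
    by (auto simp: space_pair_measure space_restrict_space)
  finally have "(\<lambda>z. measure (markov_kernel C (fst z)) {0..snd z}) \<in> borel_measurable borel_sq"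
    by (rule measure_measurable_prob_algebra2) (rule measurable_compose[OF fst markov_kernel_measurable])
  then have "(\<lambda>z. if z \<in> unit_sq then measure (markov_kernel C (fst z)) {0..snd z} else 0) \<in> borel_measurable borel"
    by (subst (asm) measurable_restrict_space_iff[where c=0]) (auto simp: Times_borel)
  then show ?thesis by (rule measurable_cong[THEN iffD1, rotated]) (auto simp: kcdf_def mem_Times_iff)
qed

lemma kcdf_measurable[measurable]: "(\<lambda>x. kcdf C x y) \<in> borel_measurable borel"
  using measurable_compose[OF _ kcdf_borel_measurable, of "\<lambda>x. (x, y)" borel]
  by (simp add: borel_prod[symmetric])

text \<open>The kernel identity for the rectangle \<open>{0..x} \<times> {0..y}\<close>. It is the
  link between the kernel picked by \<open>SOME\<close> and the values of the copula.\<close>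

lemma copula_eq_integral_kcdf:
  assumes "x \<in> unit_ivl" "y \<in> unit_ivl"
  shows "C (x, y) = (LINT s:{0..x}|lborel. kcdf C s y)"
proof -
  obtain M where M: "copula_law M" "C = restrict (cdf2 M) unit_sq" using C by (auto simp: copulas_eq)
  interpret copula_law M by fact
  have "emeasure M ({..x} \<times> {..y}) = emeasure M ({0..x} \<times> {0..y})"
    using AE_unit_sq by (intro emeasure_eq_AE) (auto elim!: eventually_mono)
  also have "\<dots> = emeasure (restrict_space M unit_sq) ({0..x} \<times> {0..y})"
    using assms by (intro emeasure_restrict_space[symmetric]) auto
  also have "\<dots> = (\<integral>\<^sup>+s\<in>unit_ivl. emeasure (markov_kernel C s) {v. (s, v) \<in> {0..x} \<times> {0..y}} \<partial>lborel)"
  proof -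
    have "{0..x} \<times> {0..y} \<in> sets borel_sq" using assms by (auto simp: sets_restrict_space_iff Times_borel)
    then show ?thesis
      using markov_kernel unfolding is_markov_kernel_of_def M(2) copula_measure_eq by blast
  qed
  also have "\<dots> = (\<integral>\<^sup>+s\<in>{0..x}. ennreal (kcdf C s y) \<partial>lborel)"
  proof (intro nn_integral_cong)
    fix s
    show "emeasure (markov_kernel C s) {v. (s, v) \<in> {0..x} \<times> {0..y}} * indicator unit_ivl s
        = ennreal (kcdf C s y) * indicator {0..x} s"
    proof (cases "s \<in> {0..x}")
      case True
      then interpret P: prob_space "markov_kernel C s" using assms by (intro markov_kernel_prob) auto
      have "{v. (s, v) \<in> {0..x} \<times> {0..y}} = {0..y}" using True by auto
      then show ?thesis using True assms by (simp add: kcdf_def P.emeasure_eq_measure)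
    qed auto
  qed
  also have "\<dots> = ennreal (LINT s:{0..x}|lborel. kcdf C s y)"
  proof -
    have "integrable lborel (\<lambda>s. indicator {0..x} s *\<^sub>R kcdf C s y)"
      by (rule Bochner_Integration.integrable_bound[of _ "indicator {0..x} :: real \<Rightarrow> real"])
         (auto simp: kcdf_nonneg kcdf_le_1 kcdf_measurable emeasure_lborel_Icc_eq split: split_indicator intro!: AE_I2)
    then show ?thesis
      unfolding set_lebesgue_integral_def
      by (subst nn_integral_eq_integral[symmetric])
         (auto intro!: nn_integral_cong simp: kcdf_nonneg indicator_def)
  qed
  finally have "ennreal (C (x, y)) = ennreal (LINT s:{0..x}|lborel. kcdf C s y)"
    using assms by (simp add: M(2) cdf2_def emeasure_eq_measure)
  moreover have "0 \<le> (LINT s:{0..x}|lborel. kcdf C s y)"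
    unfolding set_lebesgue_integral_def by (intro Bochner_Integration.integral_nonneg) (simp add: kcdf_nonneg)
  moreover have "0 \<le> C (x, y)" using assms by (simp add: M(2) cdf2_def)
  ultimately show ?thesis by simp
qed

end

section \<open>The metrics\<close>

text \<open>For positive arguments this is convexity of \<open>powr\<close>. If \<open>s\<close> or
  \<open>t\<close> is 0, it reduces to \<open>w powr p \<le> w\<close> for a weight \<open>w\<close>
  in the unit interval.\<close>

lemma powr_convex_combination:
  fixes p s t u v :: real
  assumes "p \<ge> 1" "0 \<le> s" "0 \<le> t" "0 \<le> u" "0 \<le> v" "u + v = 1"
  shows "(u * s + v * t) powr p \<le> u * s powr p + v * t powr p"
proof -
  have zero: "(w * x) powr p \<le> w * x powr p" if "0 \<le> w" "w \<le> 1" "0 \<le> x" for w x :: real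
    using that powr_mono'[of 1 p w] assms(1) by (auto simp: powr_mult intro!: mult_right_mono)
  consider "s = 0" | "t = 0" | "s > 0" "t > 0" using assms by linarith
  then show ?thesis
  proof cases
    case 3
    have u: "1 - v = u" using assms by simp
    show ?thesis
      using convex_onD[OF powr_convex[OF assms(1)], of v s t] 3 assms by (simp add: u)
  qed (use zero[of u s] zero[of v t] assms in auto)
qed

text \<open>Divide \<open>f\<close> and \<open>g\<close> by numbers \<open>a\<close>,
  \<open>b\<close> slightly larger than their norms; the slack \<open>e / 2\<close> keeps them
  positive when a norm vanishes. Then \<open>\<bar>f + g\<bar> / (a + b)\<close> is at most the
  convex combination of \<open>\<bar>f\<bar> / a\<close> and \<open>\<bar>g\<bar> / b\<close> with
  weights \<open>u\<close>, \<open>v\<close>. Convexity followed by integration bounds its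
  \<open>p\<close>-th power by 1.\<close>

lemma minkowski:
  fixes f g :: "'a \<Rightarrow> real"
  assumes p: "p \<ge> 1"
    and f: "integrable M (\<lambda>x. \<bar>f x\<bar> powr p)" and g: "integrable M (\<lambda>x. \<bar>g x\<bar> powr p)"
  shows "(\<integral>x. \<bar>f x + g x\<bar> powr p \<partial>M) powr (1 / p)
    \<le> (\<integral>x. \<bar>f x\<bar> powr p \<partial>M) powr (1 / p) + (\<integral>x. \<bar>g x\<bar> powr p \<partial>M) powr (1 / p)"
    (is "?L \<le> ?F + ?G")
proof (rule field_le_epsilon)
  fix e :: real assume e: "e > 0"
  define a b where "a = ?F + e / 2" and "b = ?G + e / 2"
  have ab: "a > 0" "b > 0" using e by (auto simp: a_def b_def intro: add_nonneg_pos)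
  have root: "X \<le> (X powr (1 / p) + e / 2) powr p" if "X \<ge> 0" for X
  proof -
    have "X = (X powr (1 / p)) powr p" using p that by (simp add: powr_powr)
    also have "\<dots> \<le> (X powr (1 / p) + e / 2) powr p" using p e by (intro powr_mono2) auto
    finally show ?thesis .
  qed
  have Fa: "(\<integral>x. \<bar>f x\<bar> powr p \<partial>M) \<le> a powr p" and Gb: "(\<integral>x. \<bar>g x\<bar> powr p \<partial>M) \<le> b powr p"
    unfolding a_def b_def by (auto intro!: root Bochner_Integration.integral_nonneg)
  define u v where "u = a / (a + b)" and "v = b / (a + b)"
  have uv: "u \<ge> 0" "v \<ge> 0" "u + v = 1" using ab by (auto simp: u_def v_def add_divide_distrib[symmetric])
  have pointwise: "\<bar>f x + g x\<bar> powr p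
      \<le> (a + b) powr p * (u * (\<bar>f x\<bar> powr p / a powr p) + v * (\<bar>g x\<bar> powr p / b powr p))" for x
  proof -
    have "u * (\<bar>f x\<bar> / a) = \<bar>f x\<bar> / (a + b)" "v * (\<bar>g x\<bar> / b) = \<bar>g x\<bar> / (a + b)"
      using ab by (auto simp: u_def v_def)
    then have "(a + b) * (u * (\<bar>f x\<bar> / a) + v * (\<bar>g x\<bar> / b)) = \<bar>f x\<bar> + \<bar>g x\<bar>"
      using ab by (simp add: add_divide_distrib[symmetric])
    then have "\<bar>f x + g x\<bar> powr p \<le> ((a + b) * (u * (\<bar>f x\<bar> / a) + v * (\<bar>g x\<bar> / b))) powr p"
      using p by (intro powr_mono2) (auto simp: abs_triangle_ineq)
    also have "\<dots> = (a + b) powr p * (u * (\<bar>f x\<bar> / a) + v * (\<bar>g x\<bar> / b)) powr p"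
      using ab uv by (simp add: powr_mult)
    also have "\<dots> \<le> (a + b) powr p * (u * (\<bar>f x\<bar> / a) powr p + v * (\<bar>g x\<bar> / b) powr p)"
      using ab uv p by (intro mult_left_mono powr_convex_combination) auto
    finally show ?thesis using ab by (simp add: powr_divide)
  qed
  have "(\<integral>x. \<bar>f x + g x\<bar> powr p \<partial>M)
      \<le> (\<integral>x. (a + b) powr p * (u * (\<bar>f x\<bar> powr p / a powr p) + v * (\<bar>g x\<bar> powr p / b powr p)) \<partial>M)"
    using pointwise uv f g by (intro integral_mono') auto
  also have "\<dots> = (a + b) powr p * (u * ((\<integral>x. \<bar>f x\<bar> powr p \<partial>M) / a powr p) + v * ((\<integral>x. \<bar>g x\<bar> powr p \<partial>M) / b powr p))"
    using f g by simp
  also have "\<dots> \<le> (a + b) powr p * (u * 1 + v * 1)"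
    using Fa Gb ab uv by (intro mult_left_mono add_mono) auto
  finally have "(\<integral>x. \<bar>f x + g x\<bar> powr p \<partial>M) \<le> (a + b) powr p" using uv by simp
  then have "?L \<le> ((a + b) powr p) powr (1 / p)" using p by (intro powr_mono2 Bochner_Integration.integral_nonneg) auto
  also have "\<dots> = a + b" using p ab by (simp add: powr_powr)
  finally show "?L \<le> ?F + ?G + e" by (simp add: a_def b_def)
qed

section \<open>Copulas are determined by their kernels up to null sets\<close>

lemma AE_lborel_dense:
  fixes a :: real
  assumes "AE y in lborel. P y" "a < b"
  obtains y where "a < y" "y < b" "P y"
proof (rule ccontr)
  assume "\<not> thesis"
  then have "AE y in lborel. y \<notin> {a<..<b}"
    using assms(1) that by (auto elim!: eventually_mono)
  then have "emeasure lborel {a<..<b} = 0" by (subst (asm) AE_iff_measurable[where N="{a<..<b}"]) auto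
  then show False using assms(2) by simp
qed

text \<open>The increment is the mass of part of a horizontal strip, whose total mass is given by
  the uniform second marginal.\<close>

lemma copula_Lipschitz2:
  assumes C: "C \<in> copulas" and x: "x \<in> unit_ivl" and y: "y \<in> unit_ivl" "z \<in> unit_ivl"
  shows "\<bar>C (x, y) - C (x, z)\<bar> \<le> \<bar>y - z\<bar>"
  using y
proof (induction y z rule: linorder_wlog)
  case (le y z)
  obtain M where M: "copula_law M" "C = restrict (cdf2 M) unit_sq" using C by (auto simp: copulas_eq)
  interpret copula_law M by fact
  have "measure M ({..x} \<times> {..z}) = measure M ({..x} \<times> {..y}) + measure M ({..x} \<times> {y<..z})"
    using le by (subst finite_measure_Union[symmetric]) (auto intro!: arg_cong[where f="measure M"])
  moreover have "measure M ({..x} \<times> {y<..z}) \<le> measure M (UNIV \<times> {y<..z})"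
    by (intro finite_measure_mono) auto
  moreover have "emeasure M (UNIV \<times> {y<..z}) = ennreal (z - y)"
  proof -
    have "unit_ivl \<inter> {y<..z} = {y<..z}" using le by auto
    then show ?thesis using le by (subst emeasure_snd) auto
  qed
  then have "measure M (UNIV \<times> {y<..z}) = z - y" using le by (simp add: measure_def)
  ultimately show ?case using le x by (simp add: M(2) cdf2_def)
qed (simp add: abs_minus_commute)

text \<open>For almost every \<open>y\<close>, integrating the kernels in \<open>x\<close> gives
  equality of the copulas at height \<open>y\<close>. Such heights are dense, and Lipschitz
  continuity in \<open>y\<close> carries the equality to all others. Off the square both functions
  are \<open>undefined\<close>.\<close>

lemma copula_eqI_AE:
  assumes A: "A \<in> copulas" and B: "B \<in> copulas"
    and eq: "AE y in lborel. AE x in lborel. kcdf A x y = kcdf B x y"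
  shows "A = B"
proof
  fix z :: "real \<times> real"
  obtain x y where z: "z = (x, y)" by (cases z)
  show "A z = B z"
  proof (cases "x \<in> unit_ivl \<and> y \<in> unit_ivl")
    case True
    have "\<bar>A (x, y) - B (x, y)\<bar> \<le> e" if e: "e > 0" for e
    proof -
      \<comment> \<open>A good height within \<open>e / 2\<close> costs two Lipschitz errors, one
        for each copula, hence \<open>e\<close> in total; \<open>a\<close> and \<open>b\<close> keep
        it inside the unit interval.\<close>
      define d where "d = min (e / 2) 1"
      define a where "a = max 0 (y - d)"
      define b where "b = min 1 (y + d)"
      have "a < b" using True e by (auto simp: a_def b_def d_def)
      then obtain y' where y': "a < y'" "y' < b" "AE x in lborel. kcdf A x y' = kcdf B x y'"
        using AE_lborel_dense[OF eq] by metis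
      moreover have "d \<le> e / 2" by (simp add: d_def)
      moreover from y' have "y - d < y'" "y' < y + d" "y' \<in> unit_ivl" by (auto simp: a_def b_def)
      ultimately have y'_in: "y' \<in> unit_ivl" "\<bar>y - y'\<bar> \<le> e / 2" by linarith+
      have "A (x, y') = B (x, y')"
      proof -
        have "(LINT s:{0..x}|lborel. kcdf A s y') = (LINT s:{0..x}|lborel. kcdf B s y')"
          unfolding set_lebesgue_integral_def
        proof (rule integral_cong_AE)
          show "AE s in lborel. indicator {0..x} s *\<^sub>R kcdf A s y' = indicator {0..x} s *\<^sub>R kcdf B s y'"
            using y'(3) by eventually_elim simp
        qed (use kcdf_measurable[OF A] kcdf_measurable[OF B] in auto)
        then show ?thesis
          using True y'_in by (simp add: copula_eq_integral_kcdf A B)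
      qed
      then show ?thesis
        using copula_Lipschitz2[OF A, of x y y'] copula_Lipschitz2[OF B, of x y y'] True y'_in by linarith
    qed
    then show ?thesis using field_le_epsilon[of "\<bar>A (x, y) - B (x, y)\<bar>" 0] z by auto
  next
    case False
    then show ?thesis using A B by (auto simp: copulas_eq z)
  qed
qed

lemma kcdf_outside: "(x, y) \<notin> unit_sq \<Longrightarrow> kcdf C x y = 0"
  by (auto simp: kcdf_def)

lemma kcdf_diff_le_1:
  assumes "A \<in> copulas" "B \<in> copulas"
  shows "\<bar>kcdf A x y - kcdf B x y\<bar> \<le> 1"
  using kcdf_nonneg[OF assms(1), of x y] kcdf_nonneg[OF assms(2), of x y]
    kcdf_le_1[OF assms(1), of x y] kcdf_le_1[OF assms(2), of x y]
  by linarith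

section \<open>The distances as integrals over the whole space, and their bounds\<close>

lemma integrable_unit_sq: "integrable lborel (indicator unit_sq :: real \<times> real \<Rightarrow> real)"
  and integral_unit_sq: "integral\<^sup>L lborel (indicator unit_sq :: real \<times> real \<Rightarrow> real) = 1"
proof -
  have "emeasure lborel unit_sq = 1"
    unfolding lborel_prod[symmetric] by (subst lborel.emeasure_pair_measure_Times) auto
  then show "integrable lborel (indicator unit_sq :: real \<times> real \<Rightarrow> real)"
    "integral\<^sup>L lborel (indicator unit_sq :: real \<times> real \<Rightarrow> real) = 1"
    by (auto simp: Times_borel measure_def)
qed

lemma D_top_eq:
  "D top A B = enn2real (SUP y\<in>unit_ivl. ennreal (\<integral>x. \<bar>kcdf A x y - kcdf B x y\<bar> \<partial>lborel))"
  unfolding D_def set_lebesgue_integral_def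
  by (auto intro!: arg_cong[where f=enn2real] SUP_cong arg_cong[where f=ennreal] Bochner_Integration.integral_cong
      simp: kcdf_def indicator_def)

lemma D_finite_eq:
  assumes "p \<noteq> top"
  shows "D p A B = (\<integral>z. \<bar>kcdf A (fst z) (snd z) - kcdf B (fst z) (snd z)\<bar> powr enn2real p \<partial>lborel)
    powr (1 / enn2real p)"
  using assms unfolding D_def set_lebesgue_integral_def
  by (auto intro!: arg_cong[where f="\<lambda>x. x powr _"] Bochner_Integration.integral_cong
      simp: kcdf_def indicator_def mem_Times_iff)

context
  fixes A B assumes AB: "A \<in> copulas" "B \<in> copulas"
begin

lemma integrable_kcdf_diff: "integrable lborel (\<lambda>x. \<bar>kcdf A x y - kcdf B x y\<bar>)"
proof (rule Bochner_Integration.integrable_bound)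
  show "integrable lborel (indicator unit_ivl :: real \<Rightarrow> real)" by simp
  show "AE x in lborel. norm \<bar>kcdf A x y - kcdf B x y\<bar> \<le> norm (indicator unit_ivl x :: real)"
    using kcdf_diff_le_1[OF AB] by (intro AE_I2) (auto simp: indicator_def kcdf_outside)
qed (use AB in \<open>simp add: kcdf_measurable\<close>)

lemma kcdf_diff_measurable:
  "(\<lambda>z. kcdf A (fst z) (snd z) - kcdf B (fst z) (snd z)) \<in> borel_measurable borel"
  using AB by (intro borel_measurable_diff kcdf_borel_measurable)

lemma integrable_kcdf_diff_powr:
  assumes "q \<ge> 1"
  shows "integrable lborel (\<lambda>z. \<bar>kcdf A (fst z) (snd z) - kcdf B (fst z) (snd z)\<bar> powr q)"
proof (rule Bochner_Integration.integrable_bound[OF integrable_unit_sq])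
  show "(\<lambda>z. \<bar>kcdf A (fst z) (snd z) - kcdf B (fst z) (snd z)\<bar> powr q) \<in> borel_measurable lborel"
    using kcdf_diff_measurable by simp
  have "\<bar>t\<bar> powr q \<le> 1" if "\<bar>t\<bar> \<le> 1" for t :: real
    using that assms powr_mono2[of q "\<bar>t\<bar>" 1] by auto
  then show "AE z in lborel. norm (\<bar>kcdf A (fst z) (snd z) - kcdf B (fst z) (snd z)\<bar> powr q)
      \<le> norm (indicator unit_sq z :: real)"
    using kcdf_diff_le_1[OF AB] by (intro AE_I2) (auto simp: indicator_def kcdf_outside)
qed

text \<open>This keeps the supremum away from \<open>top\<close>, which \<open>enn2real\<close>
  would send to 0; separation and the triangle inequality for \<open>p = top\<close> rely on
  it.\<close>

lemma SUP_kcdf_diff_le_1: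
  "(SUP y\<in>unit_ivl. ennreal (\<integral>x. \<bar>kcdf A x y - kcdf B x y\<bar> \<partial>lborel)) \<le> 1"
proof (rule SUP_least)
  fix y :: real assume "y \<in> unit_ivl"
  have "(\<integral>x. \<bar>kcdf A x y - kcdf B x y\<bar> \<partial>lborel) \<le> (\<integral>x. indicator unit_ivl x \<partial>lborel)"
  proof (rule integral_mono[OF integrable_kcdf_diff])
    show "\<bar>kcdf A x y - kcdf B x y\<bar> \<le> indicator unit_ivl x" for x
      using kcdf_diff_le_1[OF AB, of x y] by (auto simp: indicator_def kcdf_outside)
  qed simp
  then show "ennreal (\<integral>x. \<bar>kcdf A x y - kcdf B x y\<bar> \<partial>lborel) \<le> 1" by simp
qed

lemma D_eq_0_imp_eq:
  assumes "1 \<le> p" "D p A B = 0"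
  shows "A = B"
proof (rule copula_eqI_AE[OF AB])
  show "AE y in lborel. AE x in lborel. kcdf A x y = kcdf B x y"
  proof (cases "p = top")
    case True
    have "AE x in lborel. kcdf A x y = kcdf B x y" for y
    proof (cases "y \<in> unit_ivl")
      case y: True
      let ?S = "SUP y\<in>unit_ivl. ennreal (\<integral>x. \<bar>kcdf A x y - kcdf B x y\<bar> \<partial>lborel)"
      have "?S \<noteq> top" by (rule neq_top_trans[OF ennreal_one_neq_top SUP_kcdf_diff_le_1])
      then have "?S = 0" using assms(2) unfolding True D_top_eq enn2real_eq_0_iff by blast
      moreover have "ennreal (\<integral>x. \<bar>kcdf A x y - kcdf B x y\<bar> \<partial>lborel) \<le> ?S"
        using y by (intro SUP_upper)
      ultimately have "(\<integral>x. \<bar>kcdf A x y - kcdf B x y\<bar> \<partial>lborel) = 0"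
        by (intro antisym Bochner_Integration.integral_nonneg) (simp_all add: ennreal_eq_0_iff)
      then show ?thesis
        by (subst (asm) integral_nonneg_eq_0_iff_AE[OF integrable_kcdf_diff]) auto
    qed (simp add: kcdf_outside)
    then show ?thesis by simp
  next
    case False
    define q where "q = enn2real p"
    have q: "q \<ge> 1" using assms(1) False enn2real_mono[of 1 p] by (simp add: q_def less_top)
    have "(\<integral>z. \<bar>kcdf A (fst z) (snd z) - kcdf B (fst z) (snd z)\<bar> powr q \<partial>lborel) = 0"
      using assms(2) q unfolding D_finite_eq[OF False] q_def[symmetric] by simp
    then have "AE z in lborel. \<bar>kcdf A (fst z) (snd z) - kcdf B (fst z) (snd z)\<bar> powr q = 0"
      by (subst (asm) integral_nonneg_eq_0_iff_AE[OF integrable_kcdf_diff_powr[OF q]]) auto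
    then have "AE z in lborel. kcdf A (fst z) (snd z) = kcdf B (fst z) (snd z)" by simp
    \<comment> \<open>Fubini delivers \<open>x\<close> as the outer variable, whereas
      \<open>copula_eqI_AE\<close> wants \<open>y\<close> outermost; the swap needs the equality set
      to be measurable.\<close>
    then have "AE x in lborel. AE y in lborel. kcdf A x y = kcdf B x y"
      unfolding lborel_prod[symmetric] by (auto dest: lborel_pair.AE_pair)
    moreover have "{z \<in> space (lborel \<Otimes>\<^sub>M lborel). kcdf A (fst z) (snd z) = kcdf B (fst z) (snd z)} \<in> sets (lborel \<Otimes>\<^sub>M lborel)"
      unfolding lborel_prod using AB by (intro borel_measurable_eq) (auto intro: kcdf_borel_measurable)
    ultimately show ?thesis by (subst (asm) lborel_pair.AE_commute)
  qed
qed

text \<open>Both the interval and the square have measure 1, so every one of the norms is at most a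
  uniform bound. The null set in the hypothesis may depend on \<open>y\<close>; Fubini turns the
  family of bounds into one almost everywhere on the square.\<close>

lemma D_le:
  assumes p: "1 \<le> p" and e: "0 \<le> e"
    and le: "\<And>y. y \<in> unit_ivl \<Longrightarrow> AE x in lborel. \<bar>kcdf A x y - kcdf B x y\<bar> \<le> e"
  shows "D p A B \<le> e"
proof (cases "p = top")
  case True
  have "(\<integral>x. \<bar>kcdf A x y - kcdf B x y\<bar> \<partial>lborel) \<le> e" if "y \<in> unit_ivl" for y
  proof -
    have "(\<integral>x. \<bar>kcdf A x y - kcdf B x y\<bar> \<partial>lborel) \<le> (\<integral>x. e * indicator unit_ivl x \<partial>lborel)"
      using le[OF that] by (intro integral_mono_AE integrable_kcdf_diff) (auto elim!: eventually_mono simp: kcdf_def)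
    then show ?thesis by simp
  qed
  then have "(SUP y\<in>unit_ivl. ennreal (\<integral>x. \<bar>kcdf A x y - kcdf B x y\<bar> \<partial>lborel)) \<le> ennreal e"
    by (intro SUP_least ennreal_leI)
  then show ?thesis unfolding True D_top_eq using e by (intro enn2real_leI) auto
next
  case False
  define q where "q = enn2real p"
  have q: "q \<ge> 1" using p False enn2real_mono[of 1 p] by (simp add: q_def less_top)
  let ?f = "\<lambda>z. \<bar>kcdf A (fst z) (snd z) - kcdf B (fst z) (snd z)\<bar>"
  have meas: "{z \<in> space (lborel \<Otimes>\<^sub>M lborel). ?f z \<le> e} \<in> sets (lborel \<Otimes>\<^sub>M lborel)"
    unfolding lborel_prod using kcdf_diff_measurable by (intro borel_measurable_le borel_measurable_abs) auto
  have "AE x in lborel. \<bar>kcdf A x y - kcdf B x y\<bar> \<le> e" for y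
    using le[of y] e by (cases "y \<in> unit_ivl") (auto simp: kcdf_def)
  then have "AE y in lborel. AE x in lborel. \<bar>kcdf A x y - kcdf B x y\<bar> \<le> e" by simp
  then have "AE x in lborel. AE y in lborel. \<bar>kcdf A x y - kcdf B x y\<bar> \<le> e"
    using lborel_pair.AE_commute[OF meas] by simp
  then have "AE z in lborel. ?f z \<le> e"
    unfolding lborel_prod[symmetric] by (subst (asm) lborel_pair.AE_pair_iff[OF meas])
  then have "AE z in lborel. ?f z powr q \<le> e powr q * indicator unit_sq z"
  proof eventually_elim
    case (elim z)
    then show ?case using q by (auto simp: indicator_def kcdf_def mem_Times_iff intro!: powr_mono2)
  qed
  then have "(\<integral>z. ?f z powr q \<partial>lborel) \<le> (\<integral>z. e powr q * indicator unit_sq z \<partial>lborel)"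
    using integrable_unit_sq by (intro integral_mono_AE integrable_kcdf_diff_powr[OF q]) auto
  also have "\<dots> = e powr q" using integral_unit_sq by simp
  finally have "(\<integral>z. ?f z powr q \<partial>lborel) powr (1 / q) \<le> (e powr q) powr (1 / q)"
    using q by (intro powr_mono2 Bochner_Integration.integral_nonneg) auto
  also have "\<dots> = e" using q e by (simp add: powr_powr)
  finally show ?thesis unfolding D_finite_eq[OF False] q_def .
qed

end

lemma D_triangle:
  assumes A: "A \<in> copulas" and B: "B \<in> copulas" and C: "C \<in> copulas" and p: "1 \<le> p"
  shows "D p A C \<le> D p A B + D p B C"
proof (cases "p = top")
  case True
  define I where "I X Y y = (\<integral>x. \<bar>kcdf X x y - kcdf Y x y\<bar> \<partial>lborel)" for X Y y
  define S where "S X Y = (SUP y\<in>unit_ivl. ennreal (I X Y y))" for X Y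
  have S_le: "S X Y \<le> 1" if "X \<in> copulas" "Y \<in> copulas" for X Y
    using SUP_kcdf_diff_le_1[OF that] by (simp add: S_def I_def)
  have "I A C y \<le> I A B y + I B C y" for y
  proof -
    have "I A C y \<le> (\<integral>x. \<bar>kcdf A x y - kcdf B x y\<bar> + \<bar>kcdf B x y - kcdf C x y\<bar> \<partial>lborel)"
      unfolding I_def using A B C by (intro integral_mono Bochner_Integration.integrable_add integrable_kcdf_diff) auto
    also have "\<dots> = I A B y + I B C y"
      unfolding I_def using A B C by (intro Bochner_Integration.integral_add integrable_kcdf_diff)
    finally show ?thesis .
  qed
  moreover have I_nonneg: "0 \<le> I X Y y" for X Y y by (simp add: I_def)
  ultimately have "ennreal (I A C y) \<le> S A B + S B C" if "y \<in> unit_ivl" for y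
    using that unfolding S_def
    by (intro order_trans[OF ennreal_leI[of "I A C y" "I A B y + I B C y"]])
       (auto intro!: add_mono SUP_upper)
  then have "S A C \<le> S A B + S B C" unfolding S_def[of A C] by (intro SUP_least)
  then have "enn2real (S A C) \<le> enn2real (S A B + S B C)"
    using S_le[OF A B] S_le[OF B C] by (intro enn2real_mono) (auto simp: less_top[symmetric] top_unique)
  also have "\<dots> = enn2real (S A B) + enn2real (S B C)"
    using S_le[OF A B] S_le[OF B C] by (intro enn2real_plus) (auto simp: less_top[symmetric] top_unique)
  finally show ?thesis unfolding True D_top_eq S_def I_def .
next
  case False
  define q where "q = enn2real p"
  have q: "q \<ge> 1" using p False enn2real_mono[of 1 p] by (simp add: q_def less_top)
  show ?thesis
    using minkowski[OF q integrable_kcdf_diff_powr[OF A B q] integrable_kcdf_diff_powr[OF B C q]]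
    unfolding D_finite_eq[OF False] q_def by simp
qed

lemma D_nonneg: "0 \<le> D p A B"
  by (simp add: D_def)

lemma Metric_space_D:
  assumes "1 \<le> p"
  shows "Metric_space copulas (D p)"
proof
  show "D p x y = D p y x" for x y by (simp only: D_def abs_minus_commute)
  show "D p x y = 0 \<longleftrightarrow> x = y" if "x \<in> copulas" "y \<in> copulas" for x y
  proof
    assume "x = y"
    then have "D p x y \<le> 0" using that assms by (intro D_le) auto
    then show "D p x y = 0" using D_nonneg by (rule antisym)
  qed (rule D_eq_0_imp_eq[OF that assms])
qed (simp_all add: D_nonneg D_triangle assms)

section \<open>Mixtures of rotations\<close>

context copula_law
begin

lemma prob_strip_le:
  assumes "a \<le> b"
  shows "prob ({a<..b} \<times> {..y}) \<le> b - a"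
proof -
  have "emeasure M ({a<..b} \<times> {..y}) \<le> emeasure M ({a<..b} \<times> UNIV)"
    by (intro emeasure_mono) auto
  also have "\<dots> = emeasure lborel (unit_ivl \<inter> {a<..b})" by (rule emeasure_fst) simp
  also have "\<dots> \<le> emeasure lborel {a<..b}" by (intro emeasure_mono) auto
  also have "\<dots> = ennreal (b - a)" using assms by simp
  finally show ?thesis using assms by (simp add: emeasure_eq_measure)
qed

lemma cdf2_diff:
  assumes "a \<le> b"
  shows "cdf2 M (b, y) - cdf2 M (a, y) = prob ({a<..b} \<times> {..y})"
proof -
  have "prob ({..a} \<times> {..y} \<union> {a<..b} \<times> {..y}) = prob ({..a} \<times> {..y}) + prob ({a<..b} \<times> {..y})"
    by (intro finite_measure_Union) auto
  moreover have "{..a} \<times> {..y} \<union> {a<..b} \<times> {..y} = {..b} \<times> {..y}" using assms by auto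
  ultimately show ?thesis by (simp add: cdf2_def)
qed

text \<open>Joint measurability matters because \<open>cdf2\<close> will be evaluated at points
  whose two coordinates both move with \<open>x\<close>. Quadrants are sections of a closed set, to
  which the constant kernel \<open>M\<close> is applied.\<close>

lemma cdf2_measurable: "cdf2 M \<in> borel_measurable borel"
proof -
  have "Sigma (space borel) (\<lambda>z. {..fst z} \<times> {..snd z})
      = {w :: (real \<times> real) \<times> (real \<times> real). fst (snd w) \<le> fst (fst w) \<and> snd (snd w) \<le> snd (fst w)}"
    by auto
  also have "\<dots> \<in> sets (borel \<Otimes>\<^sub>M borel)"
    by (simp only: borel_prod) (intro borel_closed closed_Collect_conj closed_Collect_le continuous_intros)
  finally have "(\<lambda>z. measure M ({..fst z} \<times> {..snd z})) \<in> borel_measurable borel"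
    by (rule measure_measurable_prob_algebra2)
      (auto intro!: measurable_const simp: space_prob_algebra sets_M prob_space_axioms)
  then show ?thesis by (simp add: cdf2_def case_prod_beta')
qed

end

text \<open>The right difference quotient minus the left one for step \<open>h\<close>, hence the
  division by \<open>h\<close> and not by its square. A limit along \<open>h = 1 / Suc k\<close>
  measures the jump of slope at \<open>x\<close>.\<close>

definition second_quotient :: "(real \<Rightarrow> real) \<Rightarrow> real \<Rightarrow> real \<Rightarrow> real" where
  "second_quotient f x h = (f (x + h) + f (x - h) - 2 * f x) / h"

lemma second_quotient_tendsto_0:
  assumes "(f has_real_derivative d) (at x)"
  shows "(\<lambda>k. second_quotient f x (1 / Suc k)) \<longlonglongrightarrow> 0"
proof -
  have lim: "((\<lambda>h. (f (x + h) - f x) / h) \<longlongrightarrow> d) (at 0)" using assms by (simp add: DERIV_def)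
  have pos: "filterlim (\<lambda>k. 1 / real (Suc k)) (at 0) sequentially"
    using LIMSEQ_Suc[OF lim_1_over_n] by (simp add: filterlim_at del: of_nat_Suc)
  have "filterlim (\<lambda>k. - (1 / real (Suc k))) (at 0) sequentially"
    using tendsto_minus[of "\<lambda>k. 1 / real (Suc k)" 0] pos by (simp add: filterlim_at del: of_nat_Suc)
  from tendsto_diff[OF filterlim_compose[OF lim pos] filterlim_compose[OF lim this]]
  show ?thesis by (simp add: second_quotient_def field_simps)
qed

text \<open>The numerator is a difference of two strip masses, each between 0 and \<open>h\<close>.
  The bound is uniform in the law and serves as the dominating function for mixtures.\<close>

lemma (in copula_law) abs_second_quotient_le_1:
  assumes "h > 0"
  shows "\<bar>second_quotient (\<lambda>t. cdf2 M (t, y)) x h\<bar> \<le> 1"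
proof -
  have "cdf2 M (x + h, y) + cdf2 M (x - h, y) - 2 * cdf2 M (x, y)
      = prob ({x<..x + h} \<times> {..y}) - prob ({x - h<..x} \<times> {..y})"
    using cdf2_diff[of x "x + h" y] cdf2_diff[of "x - h" x y] assms by simp
  moreover have "prob ({x<..x + h} \<times> {..y}) \<le> h" "prob ({x - h<..x} \<times> {..y}) \<le> h"
    using prob_strip_le[of x "x + h" y] prob_strip_le[of "x - h" x y] assms by auto
  ultimately have "\<bar>cdf2 M (x + h, y) + cdf2 M (x - h, y) - 2 * cdf2 M (x, y)\<bar> \<le> h"
    by (simp add: abs_le_iff) (smt (verit) measure_nonneg)
  then show ?thesis using assms by (simp add: second_quotient_def)
qed

text \<open>The index type is arbitrary so that both the countable mixture of rotations and the
  two-point mixture with \<open>A\<close> are instances.\<close>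

definition mixture :: "'i pmf \<Rightarrow> ('i \<Rightarrow> (real \<times> real) measure) \<Rightarrow> (real \<times> real) measure" where
  "mixture p N = measure_pmf p \<bind> N"

context
  fixes p :: "'i pmf" and N :: "'i \<Rightarrow> (real \<times> real) measure"
  assumes N: "\<And>i. copula_law (N i)"
begin

lemma mixture_kernel: "N \<in> measure_pmf p \<rightarrow>\<^sub>M subprob_algebra borel"
proof -
  have "N i \<in> space (subprob_algebra borel)" for i
  proof -
    interpret copula_law "N i" by (rule N)
    show ?thesis by (auto simp: space_subprob_algebra sets_M intro: prob_space_imp_subprob_space prob_space_axioms)
  qed
  then show ?thesis by (simp add: measurable_pmf_measure1)
qed

lemma sets_mixture: "sets (mixture p N) = sets borel"
  unfolding mixture_def by (rule sets_bind[OF copula_law.sets_M[OF N]]) simp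

lemma emeasure_mixture:
  "X \<in> sets borel \<Longrightarrow> emeasure (mixture p N) X = (\<integral>\<^sup>+i. emeasure (N i) X \<partial>measure_pmf p)"
  unfolding mixture_def by (rule emeasure_bind[OF _ mixture_kernel]) auto

lemma measure_mixture:
  "X \<in> sets borel \<Longrightarrow> measure (mixture p N) X = (\<integral>i. measure (N i) X \<partial>measure_pmf p)"
  unfolding mixture_def by (rule measure_pmf.measure_bind[OF mixture_kernel])

lemma copula_law_mixture: "copula_law (mixture p N)"
proof -
  have space: "space (mixture p N) = UNIV" using sets_eq_imp_space_eq[OF sets_mixture] by simp
  have "emeasure (N i) UNIV = 1" for i
    using prob_space.emeasure_space_1[of "N i"] copula_law.space_M[OF N] copula_law.axioms(1)[OF N] by metis
  then have one: "emeasure (mixture p N) UNIV = 1"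
    by (simp add: emeasure_mixture measure_pmf.emeasure_space_1[simplified])
  have "distr (mixture p N) borel g = unif"
    if g: "g \<in> borel \<rightarrow>\<^sub>M borel" and unif: "\<And>i. distr (N i) borel g = unif" for g :: "real \<times> real \<Rightarrow> real"
  proof (rule measure_eqI)
    fix E assume "E \<in> sets (distr (mixture p N) borel g)"
    then have E: "E \<in> sets borel" by simp
    have gE: "g -` E \<in> sets borel" using measurable_sets[OF g E] by simp
    have "emeasure (N i) (g -` E) = emeasure unif E" for i
    proof -
      interpret copula_law "N i" by (rule N)
      have "g \<in> N i \<rightarrow>\<^sub>M borel" using g unfolding measurable_cong_sets[OF sets_M refl] .
      from emeasure_distr[OF this E] show ?thesis by (simp add: unif)
    qed
    moreover have "g \<in> mixture p N \<rightarrow>\<^sub>M borel" using g unfolding measurable_cong_sets[OF sets_mixture refl] .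
    ultimately show "emeasure (distr (mixture p N) borel g) E = emeasure unif E"
      using E gE
      by (simp only: emeasure_distr space Int_UNIV_right emeasure_mixture nn_integral_const
          measure_pmf.emeasure_space_1 mult_1_right)
  qed simp
  note marginal = this
  have "(fst :: real \<times> real \<Rightarrow> real) \<in> borel \<rightarrow>\<^sub>M borel" "(snd :: real \<times> real \<Rightarrow> real) \<in> borel \<rightarrow>\<^sub>M borel"
    by (simp_all add: borel_prod[symmetric])
  note this[THEN marginal]
  then have "distr (mixture p N) borel fst = unif" "distr (mixture p N) borel snd = unif"
    by (simp_all only: copula_law.distr_fst[OF N] copula_law.distr_snd[OF N])
  then show ?thesis
    using one space sets_mixture by (auto intro!: copula_law.intro copula_law_axioms.intro prob_spaceI)
qed

lemma cdf2_mixture: "cdf2 (mixture p N) z = (\<integral>i. cdf2 (N i) z \<partial>measure_pmf p)"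
  by (simp add: cdf2_def measure_mixture Times_borel case_prod_beta)

end

section \<open>Rotations modulo 1 and the kinks of their copulas\<close>

definition rot :: "real \<Rightarrow> real \<Rightarrow> real" where
  "rot r x = (if x + r \<le> 1 then x + r else x + r - 1)"

lemma rot_measurable: "rot r \<in> borel_measurable borel"
  unfolding rot_def[abs_def] by measurable

text \<open>Equal images force \<open>r - s\<close> to be an integer of absolute value below 1. So
  at \<open>y = rot (r m) x\<close> only one component of the mixture has a kink.\<close>

lemma rot_inj:
  assumes "rot r x = rot s x" "r \<in> {0..<1}" "s \<in> {0..<1}"
  shows "r = s"
  using assms by (auto simp: rot_def split: if_splits)

lemma emeasure_lborel_translate:
  fixes S :: "real set"
  assumes "S \<in> sets borel"
  shows "emeasure lborel {x. x + c \<in> S} = emeasure lborel S"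
proof -
  have "emeasure lborel S = emeasure (distr lborel borel ((+) c)) S" by (simp add: lborel_distr_plus)
  also have "\<dots> = emeasure lborel ((+) c -` S)" using assms by (subst emeasure_distr) auto
  also have "(+) c -` S = {x. x + c \<in> S}" by (auto simp: add.commute)
  finally show ?thesis ..
qed

text \<open>The map translates \<open>[0, 1 - r]\<close> onto \<open>[r, 1]\<close> and
  \<open>(1 - r, 1]\<close> onto \<open>(0, r]\<close>. These images tile the unit interval up to
  the points 0 and \<open>r\<close>, which are null.\<close>

lemma distr_rot:
  assumes r: "r \<in> {0..<1}"
  shows "distr unif borel (rot r) = unif"
proof (rule measure_eqI)
  fix E assume "E \<in> sets (distr unif borel (rot r))"
  then have E[measurable]: "E \<in> sets borel" by simp
  have [measurable]: "{x. x + c \<in> S} \<in> sets borel" if "S \<in> sets borel" for S and c :: real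
    using that measurable_sets[of "\<lambda>x. x + c" borel borel S] by (simp add: vimage_def)
  have "emeasure (distr unif borel (rot r)) E = emeasure unif (rot r -` E)"
    using rot_measurable[of r] by (subst emeasure_distr) auto
  also have "\<dots> = emeasure lborel (unit_ivl \<inter> rot r -` E)"
    using measurable_sets[OF rot_measurable E] by (intro emeasure_unif) simp
  also have "unit_ivl \<inter> rot r -` E = {x. x + r \<in> E \<inter> {r..1}} \<union> {x. x + (r - 1) \<in> E \<inter> {0<..r}}"
    using r by (auto simp: rot_def add_diff_eq split: if_splits)
  also have "emeasure lborel \<dots> = emeasure lborel {x. x + r \<in> E \<inter> {r..1}} + emeasure lborel {x. x + (r - 1) \<in> E \<inter> {0<..r}}"
    by (rule plus_emeasure[symmetric]) auto
  also have "\<dots> = emeasure lborel (E \<inter> {r..1}) + emeasure lborel (E \<inter> {0<..r})"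
    by (simp only: emeasure_lborel_translate E sets.Int borel_closed closed_atLeastAtMost greaterThanAtMost_borel)
  also have "emeasure lborel (E \<inter> {r..1}) = emeasure lborel (E \<inter> {r<..1})"
    using AE_lborel_singleton[of r] by (intro emeasure_eq_AE) (auto elim!: eventually_mono)
  also have "emeasure lborel (E \<inter> {r<..1}) + emeasure lborel (E \<inter> {0<..r})
      = emeasure lborel (E \<inter> {r<..1} \<union> E \<inter> {0<..r})"
    by (rule plus_emeasure) auto
  also have "\<dots> = emeasure lborel (unit_ivl \<inter> E)"
    using AE_lborel_singleton[of 0] r by (intro emeasure_eq_AE) (auto elim!: eventually_mono)
  also have "\<dots> = emeasure unif E" by (rule emeasure_unif[OF E, symmetric])
  finally show "emeasure (distr unif borel (rot r)) E = emeasure unif E" .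
qed simp

definition rot_law :: "real \<Rightarrow> (real \<times> real) measure" where
  "rot_law r = distr unif borel (\<lambda>x. (x, rot r x))"

lemma graph_rot_measurable: "(\<lambda>x. (x, rot r x)) \<in> unif \<rightarrow>\<^sub>M borel"
proof -
  have "(\<lambda>x. (x, rot r x)) \<in> borel \<rightarrow>\<^sub>M borel \<Otimes>\<^sub>M borel"
    using rot_measurable by (intro measurable_Pair) auto
  then show ?thesis by (simp add: borel_prod)
qed

lemma copula_law_rot_law:
  assumes "r \<in> {0..<1}"
  shows "copula_law (rot_law r)"
proof (intro copula_law.intro copula_law_axioms.intro)
  show "prob_space (rot_law r)"
    unfolding rot_law_def by (rule prob_space.prob_space_distr[OF prob_space_unif graph_rot_measurable])
  have [measurable]: "(fst :: real \<times> real \<Rightarrow> real) \<in> borel \<rightarrow>\<^sub>M borel" "(snd :: real \<times> real \<Rightarrow> real) \<in> borel \<rightarrow>\<^sub>M borel"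
    by (simp_all add: borel_prod[symmetric])
  have "distr unif borel (\<lambda>x. x) = unif" by (rule distr_id2) simp
  then show "distr (rot_law r) borel fst = unif"
    unfolding rot_law_def by (subst distr_distr) (auto simp: graph_rot_measurable comp_def)
  show "distr (rot_law r) borel snd = unif"
    unfolding rot_law_def using distr_rot[OF assms]
    by (subst distr_distr) (auto simp: graph_rot_measurable comp_def)
qed (simp add: rot_law_def)

text \<open>For \<open>y = rot r x\<close> the left derivative of \<open>\<lambda>t. cdf2 (rot_law r) (t, y)\<close> at \<open>x\<close> is 1 and the
  right derivative is 0, whereas for other \<open>y\<close> the two agree.\<close>

lemma rot_law_second_quotient:
  assumes r: "r \<in> {0..<1}" and x: "0 < x" "x < 1" "x \<noteq> 1 - r"
  shows "\<forall>\<^sub>F k in sequentially. second_quotient (\<lambda>t. cdf2 (rot_law r) (t, y)) x (1 / Suc k)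
    = (if y = rot r x then -1 else 0)"
proof -
  interpret copula_law "rot_law r" by (rule copula_law_rot_law[OF r])
  define c where "c = rot r x"
  \<comment> \<open>Within distance \<open>d\<close> of \<open>x\<close> one stays in the unit
    interval and does not cross the break point \<open>1 - r\<close>, so the rotation is a
    translation; if \<open>y \<noteq> c\<close>, its values also stay on one side of
    \<open>y\<close>.\<close>
  define d where "d = Min ({x, 1 - x, \<bar>1 - r - x\<bar>} \<union> (if y = c then {} else {\<bar>y - c\<bar>}))"
  have d: "d > 0" using x by (auto simp: d_def)
  have d_le: "d \<le> x" "d \<le> 1 - x" "d \<le> \<bar>1 - r - x\<bar>" "y \<noteq> c \<Longrightarrow> d \<le> \<bar>y - c\<bar>"
    by (auto simp: d_def)
  have rot: "rot r s = c + (s - x)" if "\<bar>s - x\<bar> < d" for s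
    using that d_le(3) by (auto simp: rot_def c_def)
  have strip: "prob ({a<..b} \<times> {..y}) = (if S then b - a else 0)"
    if "0 \<le> a" "a \<le> b" "b \<le> 1" "\<And>s. a < s \<Longrightarrow> s \<le> b \<Longrightarrow> rot r s \<le> y \<longleftrightarrow> S" for a b S
  proof -
    have "prob ({a<..b} \<times> {..y}) = measure unif ((\<lambda>x. (x, rot r x)) -` ({a<..b} \<times> {..y}))"
      unfolding rot_law_def using graph_rot_measurable by (subst measure_distr) (auto simp: Times_borel)
    also have "(\<lambda>x. (x, rot r x)) -` ({a<..b} \<times> {..y}) = (if S then {a<..b} else {})"
      using that(4) by auto
    also have "measure unif \<dots> = measure lborel (unit_ivl \<inter> (if S then {a<..b} else {}))"
      by (simp add: measure_def emeasure_unif[of "{a<..b}", simplified])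
    also have "unit_ivl \<inter> (if S then {a<..b} else {}) = (if S then {a<..b} else {})"
      using that by auto
    finally show ?thesis using that by simp
  qed
  have "\<forall>\<^sub>F k in sequentially. 1 / real (Suc k) < d"
    using order_tendstoD(2)[OF LIMSEQ_Suc[OF lim_1_over_n] d] by simp
  then show ?thesis
  proof eventually_elim
    case (elim k)
    define h where "h = 1 / real (Suc k)"
    have h: "h > 0" "h < d" using elim by (auto simp: h_def)
    \<comment> \<open>The strict \<open>y > c\<close> here, against \<open>y \<ge> c\<close> for the
      left strip, produces the kink: at \<open>y = c\<close> only the left strip has mass.\<close>
    have right: "prob ({x<..x + h} \<times> {..y}) = (if y > c then (x + h) - x else 0)"
    proof (rule strip)
      fix s assume "x < s" "s \<le> x + h"
      then show "rot r s \<le> y \<longleftrightarrow> y > c" using h d_le(4) rot[of s] by (cases "y = c") auto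
    qed (use h d_le x in auto)
    have left: "prob ({x - h<..x} \<times> {..y}) = (if y \<ge> c then x - (x - h) else 0)"
    proof (rule strip)
      fix s assume "x - h < s" "s \<le> x"
      then show "rot r s \<le> y \<longleftrightarrow> y \<ge> c" using h d_le(4) rot[of s] by (cases "y = c") auto
    qed (use h d_le x in auto)
    have "cdf2 (rot_law r) (x + h, y) + cdf2 (rot_law r) (x - h, y) - 2 * cdf2 (rot_law r) (x, y)
        = (if y = c then - h else 0)"
      using cdf2_diff[of x "x + h" y] cdf2_diff[of "x - h" x y] h right left
      by (cases y c rule: linorder_cases) auto
    then show ?case using h unfolding second_quotient_def h_def[symmetric] c_def[symmetric] by auto
  qed
qed

text \<open>Componentwise the limit is -1 for \<open>n = m\<close> and 0 otherwise, since the graphs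
  of distinct rotations do not meet. Dominated convergence passes this through the average and
  leaves minus the weight of \<open>m\<close>.\<close>

lemma mixture_rot_law_second_quotient:
  assumes r: "\<And>n. r n \<in> {0..<1}" "inj r" and x: "0 < x" "x < 1" "\<And>n. x \<noteq> 1 - r n"
  shows "(\<lambda>k. second_quotient (\<lambda>t. cdf2 (mixture p (\<lambda>n. rot_law (r n))) (t, rot (r m) x)) x (1 / Suc k))
    \<longlonglongrightarrow> - pmf p m"
proof -
  let ?y = "rot (r m) x"
  let ?s = "\<lambda>k n. second_quotient (\<lambda>t. cdf2 (rot_law (r n)) (t, ?y)) x (1 / Suc k)"
  have law: "copula_law (rot_law (r n))" for n by (rule copula_law_rot_law[OF r(1)])
  have int: "integrable (measure_pmf p) (\<lambda>n. cdf2 (rot_law (r n)) z)" for z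
  proof (rule measure_pmf.integrable_const_bound[where B=1])
    show "AE n in measure_pmf p. norm (cdf2 (rot_law (r n)) z) \<le> 1"
      by (auto simp: cdf2_def case_prod_beta intro!: AE_I2 prob_space.prob_le_1 copula_law.axioms(1)[OF law])
  qed simp
  have eq: "second_quotient (\<lambda>t. cdf2 (mixture p (\<lambda>n. rot_law (r n))) (t, ?y)) x (1 / Suc k) = (\<integral>n. ?s k n \<partial>measure_pmf p)" for k
    unfolding cdf2_mixture[OF law] second_quotient_def
    by (simp only: Bochner_Integration.integral_divide_zero Bochner_Integration.integral_diff
        Bochner_Integration.integral_add Bochner_Integration.integrable_add int
        Bochner_Integration.integrable_mult_right Bochner_Integration.integral_mult_right_zero)
  have "(\<lambda>k. \<integral>n. ?s k n \<partial>measure_pmf p) \<longlonglongrightarrow> (\<integral>n. - indicator {m} n \<partial>measure_pmf p)"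
  proof (rule integral_dominated_convergence[where w="\<lambda>_. 1"])
    show "AE n in measure_pmf p. (\<lambda>k. ?s k n) \<longlonglongrightarrow> - indicator {m} n"
    proof (intro AE_I2)
      fix n
      have "?y = rot (r n) x \<longleftrightarrow> n = m"
        using rot_inj[of "r m" x "r n"] r by (auto dest: injD)
      then have "\<forall>\<^sub>F k in sequentially. ?s k n = - indicator {m} n"
        using rot_law_second_quotient[of "r n" x ?y] r x by (auto elim: eventually_mono)
      then show "(\<lambda>k. ?s k n) \<longlonglongrightarrow> - indicator {m} n" by (rule tendsto_eventually)
    qed
    show "AE n in measure_pmf p. norm (?s k n) \<le> 1" for k
      by (intro AE_I2) (simp add: copula_law.abs_second_quotient_le_1[OF law])
  qed auto
  then show ?thesis by (simp add: eq pmf.rep_eq del: of_nat_Suc)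
qed

section \<open>Rational rotations and the density of their orbits\<close>

lemma infinite_Rats_unit: "infinite (\<rat> \<inter> {0..<1} :: real set)"
proof
  assume fin: "finite (\<rat> \<inter> {0..<1} :: real set)"
  have 0: "0 \<in> \<rat> \<inter> {0..<1::real}" by simp
  then have "Max (\<rat> \<inter> {0..<1::real}) \<in> \<rat> \<inter> {0..<1}" using fin by (intro Max_in) auto
  then obtain q :: real where q: "q \<in> \<rat>" "Max (\<rat> \<inter> {0..<1}) < q" "q < 1"
    using Rats_dense_in_real[of "Max (\<rat> \<inter> {0..<1::real})" 1] by auto
  moreover have "0 \<le> Max (\<rat> \<inter> {0..<1::real})" using fin 0 by (intro Max_ge)
  ultimately have "q \<in> \<rat> \<inter> {0..<1}" by auto
  from Max_ge[OF fin this] q show False by simp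
qed

lemma rot_dense:
  assumes x: "0 < x" "x < 1"
  shows "unit_ivl \<subseteq> closure ((\<lambda>r. rot r x) ` (\<rat> \<inter> {0..<1}))"
proof
  fix z :: real assume z: "z \<in> unit_ivl"
  show "z \<in> closure ((\<lambda>r. rot r x) ` (\<rat> \<inter> {0..<1}))"
  proof (unfold closure_approachable, safe)
    fix e :: real assume e: "e > 0"
    define a where "a = max 0 (z - e)"
    define b where "b = min 1 (z + e)"
    have ab: "a < b" "0 \<le> a" "b \<le> 1" using z e by (auto simp: a_def b_def)
    \<comment> \<open>If \<open>x < b\<close>, the target is reached without wrapping around;
      otherwise exactly one wrap is made. Either way the admissible shifts contain an open
      interval.\<close>
    have "\<exists>r\<in>\<rat> \<inter> {0..<1}. a < rot r x \<and> rot r x < b"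
    proof (cases "x < b")
      case True
      then obtain r where r: "r \<in> \<rat>" "max 0 (a - x) < r" "r < b - x"
        using Rats_dense_in_real[of "max 0 (a - x)" "b - x"] ab by auto
      then show ?thesis using x ab by (intro bexI[of _ r]) (auto simp: rot_def)
    next
      case False
      then obtain r where r: "r \<in> \<rat>" "a - x + 1 < r" "r < b - x + 1"
        using Rats_dense_in_real[of "a - x + 1" "b - x + 1"] ab by auto
      then show ?thesis using x ab False by (intro bexI[of _ r]) (auto simp: rot_def)
    qed
    then obtain r where r: "r \<in> \<rat> \<inter> {0..<1}" "a < rot r x" "rot r x < b" by blast
    then have "dist (rot r x) z < e" by (auto simp: a_def b_def dist_real_def)
    then show "\<exists>y\<in>(\<lambda>r. rot r x) ` (\<rat> \<inter> {0..<1}). dist y z < e" using r by blast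
  qed
qed

section \<open>Density\<close>

text \<open>Half-lines replace \<open>{0..x}\<close> so that the integrals are values of the
  distribution function of the measure with density \<open>kcdf C s y\<close>.\<close>

lemma nn_integral_kcdf_atMost:
  assumes C: "C \<in> copulas" and y: "y \<in> unit_ivl"
  shows "(\<integral>\<^sup>+s. ennreal (kcdf C s y) * indicator {..x} s \<partial>lborel)
    = (if x < 0 then 0 else ennreal (C (min x 1, y)))"
proof (cases "x < 0")
  case True
  have "(\<integral>\<^sup>+s. ennreal (kcdf C s y) * indicator {..x} s \<partial>lborel) = (\<integral>\<^sup>+s. 0 \<partial>(lborel :: real measure))"
    using True by (intro nn_integral_cong) (auto simp: kcdf_outside indicator_def)
  then show ?thesis using True by simp
next
  case False
  let ?f = "\<lambda>s. indicator {0..min x 1} s *\<^sub>R kcdf C s y"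
  note [measurable] = kcdf_measurable[OF C]
  have int: "integrable lborel ?f"
    by (rule Bochner_Integration.integrable_bound[of _ "indicator {0..min x 1} :: real \<Rightarrow> real"])
       (auto simp: kcdf_nonneg[OF C] kcdf_le_1[OF C] emeasure_lborel_Icc_eq
         split: split_indicator intro!: AE_I2)
  have "(\<integral>\<^sup>+s. ennreal (kcdf C s y) * indicator {..x} s \<partial>lborel) = (\<integral>\<^sup>+s. ennreal (?f s) \<partial>lborel)"
    by (intro nn_integral_cong) (auto simp: kcdf_outside indicator_def)
  also have "\<dots> = ennreal (\<integral>s. ?f s \<partial>lborel)"
    by (rule nn_integral_eq_integral[OF int]) (auto simp: kcdf_nonneg[OF C])
  also have "(\<integral>s. ?f s \<partial>lborel) = C (min x 1, y)"
    using copula_eq_integral_kcdf[OF C, of "min x 1" y] False y by (simp add: set_lebesgue_integral_def)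
  finally show ?thesis using False by simp
qed

lemma copula_nonneg:
  assumes "C \<in> copulas" "z \<in> unit_sq"
  shows "0 \<le> C z"
  using assms by (auto simp: copulas_eq cdf2_def)

text \<open>The three kernels are picked independently, so the identity of copulas must be carried
  back to them. Both sides are densities in \<open>x\<close>; their integrals over every half-line
  agree, so the finite measures coincide and the densities agree almost everywhere, with a null set
  that may depend on \<open>y\<close>.\<close>

lemma kcdf_convex_combination:
  assumes A: "A \<in> copulas" and C: "C \<in> copulas" and B: "B \<in> copulas" and e: "0 \<le> e" "e \<le> 1"
    and eq: "\<And>z. z \<in> unit_sq \<Longrightarrow> B z = (1 - e) * A z + e * C z" and y: "y \<in> unit_ivl"
  shows "AE x in lborel. kcdf B x y = (1 - e) * kcdf A x y + e * kcdf C x y"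
proof -
  note [measurable] = kcdf_measurable[OF A] kcdf_measurable[OF B] kcdf_measurable[OF C]
  let ?g = "\<lambda>x. ennreal (kcdf B x y)"
  let ?h = "\<lambda>x. ennreal (1 - e) * ennreal (kcdf A x y) + ennreal e * ennreal (kcdf C x y)"
  have gh: "(\<integral>\<^sup>+s. ?g s * indicator {..x} s \<partial>lborel) = (\<integral>\<^sup>+s. ?h s * indicator {..x} s \<partial>lborel)" for x
  proof -
    have "(\<integral>\<^sup>+s. ?h s * indicator {..x} s \<partial>lborel)
        = (\<integral>\<^sup>+s. ennreal (1 - e) * (ennreal (kcdf A s y) * indicator {..x} s)
            + ennreal e * (ennreal (kcdf C s y) * indicator {..x} s) \<partial>lborel)"
      by (simp add: distrib_right mult.assoc)
    also have "\<dots> = ennreal (1 - e) * (if x < 0 then 0 else ennreal (A (min x 1, y)))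
        + ennreal e * (if x < 0 then 0 else ennreal (C (min x 1, y)))"
      by (simp add: nn_integral_add nn_integral_cmult nn_integral_kcdf_atMost[OF A y] nn_integral_kcdf_atMost[OF C y])
    also have "\<dots> = (if x < 0 then 0 else ennreal (B (min x 1, y)))"
      using e y eq[of "(min x 1, y)"] copula_nonneg[OF A, of "(min x 1, y)"] copula_nonneg[OF C, of "(min x 1, y)"]
      by (simp add: ennreal_mult ennreal_plus)
    finally show ?thesis using nn_integral_kcdf_atMost[OF B y] by simp
  qed
  have fin: "(\<integral>\<^sup>+s. ?g s \<partial>lborel) \<noteq> \<infinity>"
  proof -
    have "(\<integral>\<^sup>+s. ?g s \<partial>lborel) = (\<integral>\<^sup>+s. ?g s * indicator {..1} s \<partial>lborel)"
      by (intro nn_integral_cong) (auto simp: kcdf_outside indicator_def)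
    then show ?thesis by (simp add: nn_integral_kcdf_atMost[OF B y])
  qed
  have tot: "(\<integral>\<^sup>+s. ?h s \<partial>lborel) \<noteq> \<infinity>"
  proof -
    have "(\<integral>\<^sup>+s. ?h s \<partial>lborel) = (\<integral>\<^sup>+s. ?h s * indicator {..1} s \<partial>lborel)"
      by (intro nn_integral_cong) (auto simp: kcdf_outside indicator_def)
    then show ?thesis by (simp add: gh[symmetric] nn_integral_kcdf_atMost[OF B y])
  qed
  have "density lborel ?g = density lborel ?h"
  proof (rule cdf_unique')
    show "finite_borel_measure (density lborel ?g)" "finite_borel_measure (density lborel ?h)"
      using fin tot by (auto intro!: finite_borel_measure.intro finite_borel_measure_axioms.intro finite_measureI
          simp: emeasure_density)
    show "cdf (density lborel ?g) = cdf (density lborel ?h)"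
      by (auto simp: cdf_def measure_def emeasure_density gh)
  qed
  then have "AE x in lborel. ?g x = ?h x"
    using fin by (subst (asm) finite_density_unique) auto
  then show ?thesis
  proof eventually_elim
    case (elim x)
    then have "ennreal (kcdf B x y) = ennreal ((1 - e) * kcdf A x y + e * kcdf C x y)"
      using e kcdf_nonneg[OF A] kcdf_nonneg[OF C] by (simp add: ennreal_mult ennreal_plus)
    then show ?case
      using e kcdf_nonneg[OF A] kcdf_nonneg[OF B] kcdf_nonneg[OF C] by (subst (asm) ennreal_inj) auto
  qed
qed

lemma D_convex_combination_le:
  assumes A: "A \<in> copulas" and C: "C \<in> copulas" and B: "B \<in> copulas" and e: "0 \<le> e" "e \<le> 1"
    and eq: "\<And>z. z \<in> unit_sq \<Longrightarrow> B z = (1 - e) * A z + e * C z" and p: "1 \<le> p"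
  shows "D p A B \<le> e"
proof (rule D_le[OF A B p e(1)])
  fix y :: real assume y: "y \<in> unit_ivl"
  have "AE x in lborel. kcdf B x y = (1 - e) * kcdf A x y + e * kcdf C x y"
    by (rule kcdf_convex_combination[OF A C B e _ y]) (rule eq)
  then show "AE x in lborel. \<bar>kcdf A x y - kcdf B x y\<bar> \<le> e"
  proof eventually_elim
    case (elim x)
    then have "kcdf A x y - kcdf B x y = e * (kcdf A x y - kcdf C x y)" by (simp add: algebra_simps)
    then have "\<bar>kcdf A x y - kcdf B x y\<bar> = e * \<bar>kcdf A x y - kcdf C x y\<bar>" using e by (simp add: abs_mult)
    also have "\<dots> \<le> e * 1" using e kcdf_diff_le_1[OF A C] by (intro mult_left_mono) auto
    finally show ?case by simp
  qed
qed

lemma second_quotient_linear: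
  "second_quotient (\<lambda>t. a * f t + b * g t) x h = a * second_quotient f x h + b * second_quotient g x h"
proof -
  have "a * f (x + h) + b * g (x + h) + (a * f (x - h) + b * g (x - h)) - 2 * (a * f x + b * g x)
      = a * (f (x + h) + f (x - h) - 2 * f x) + b * (g (x + h) + g (x - h) - 2 * g x)"
    by (simp add: algebra_simps)
  then show ?thesis unfolding second_quotient_def by (simp only: add_divide_distrib times_divide_eq_right)
qed

text \<open>At an interior \<open>x\<close> the copula coincides near \<open>x\<close> with
  \<open>f\<close>, which is defined on the whole plane, so second quotients make sense for every
  step \<open>h\<close>.\<close>

lemma has_partial1_second_quotient:
  assumes "has_partial1 (restrict f unit_sq) x y" and x: "0 < x" "x < 1" and y: "y \<in> unit_ivl"
  shows "(\<lambda>k. second_quotient (\<lambda>t. f (t, y)) x (1 / Suc k)) \<longlonglongrightarrow> 0"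
proof -
  obtain d where "((\<lambda>t. restrict f unit_sq (t, y)) has_real_derivative d) (at x within unit_ivl)"
    using assms(1) by (auto simp: has_partial1_def)
  then have "((\<lambda>t. restrict f unit_sq (t, y)) has_real_derivative d) (at x)"
    using x by (simp add: at_within_Icc_at)
  moreover have "\<forall>\<^sub>F t in nhds x. restrict f unit_sq (t, y) = f (t, y)"
    using eventually_nhds_in_open[of "{0<..<1}" x] x y by (auto elim!: eventually_mono)
  ultimately have "((\<lambda>t. f (t, y)) has_real_derivative d) (at x)"
    by (simp add: DERIV_cong_ev)
  then show ?thesis by (rule second_quotient_tendsto_0)
qed

text \<open>Where \<open>(1 - \<epsilon>) * A + \<epsilon> * C\<close> has a partial derivative at \<open>(x, rot (r m) x)\<close>, the second
  difference quotients of \<open>A\<close> tend to \<open>\<epsilon> / (1 - \<epsilon>) * pmf p m\<close>; this is \<open>t m \<epsilon>\<close> in the proof.\<close>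

lemma copulas_Q_approx:
  assumes A: "A \<in> copulas" and d: "0 < d" "d \<le> 1"
  obtains B C e where "B \<in> copulas_Q" "C \<in> copulas" "0 < e" "e < d"
    "\<And>z. z \<in> unit_sq \<Longrightarrow> B z = (1 - e) * A z + e * C z"
proof -
  obtain MA where MA: "copula_law MA" "A = restrict (cdf2 MA) unit_sq" using A by (auto simp: copulas_eq)
  interpret MA: copula_law MA by fact
  define R where "R = (\<rat> \<inter> {0..<1} :: real set)"
  define r where "r = from_nat_into R"
  have R: "countable R" "infinite R"
    using infinite_Rats_unit by (auto simp: R_def intro: countable_subset[OF _ countable_rat])
  then have "bij_betw r UNIV R" unfolding r_def by (rule bij_betw_from_nat_into)
  then have r_inj: "inj r" and r_range: "range r = R" by (auto simp: bij_betw_def)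
  then have r_in: "r n \<in> {0..<1}" for n by (auto simp: R_def)
  \<comment> \<open>A geometric law gives every index positive weight, so each rotation contributes
    a genuine kink.\<close>
  define p where "p = geometric_pmf (1 / 2)"
  have w: "pmf p n > 0" for n by (simp add: p_def)
  define MC where "MC = mixture p (\<lambda>n. rot_law (r n))"
  have MC: "copula_law MC"
    unfolding MC_def by (intro copula_law_mixture copula_law_rot_law r_in)
  \<comment> \<open>Where the quotients diverge, \<open>lim\<close> is some unspecified value. The
    argument is safe because \<open>L m x\<close> is compared with \<open>t m e\<close> only after
    convergence to \<open>t m e\<close> has been derived.\<close>
  define L where "L m x = lim (\<lambda>k. second_quotient (\<lambda>t. cdf2 MA (t, rot (r m) x)) x (1 / Suc k))" for m x
  have [measurable]: "L m \<in> borel_measurable borel" for m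
  proof -
    have "(\<lambda>x. cdf2 MA (x + c, rot (r m) x)) \<in> borel_measurable borel" for c
    proof (rule measurable_compose[OF _ MA.cdf2_measurable])
      have "(\<lambda>x. (x + c, rot (r m) x)) \<in> borel \<rightarrow>\<^sub>M borel \<Otimes>\<^sub>M borel"
        using rot_measurable by (intro measurable_Pair) auto
      then show "(\<lambda>x. (x + c, rot (r m) x)) \<in> borel \<rightarrow>\<^sub>M borel" by (simp add: borel_prod)
    qed
    from this[of 0] this this[of "- c" for c] show ?thesis
      unfolding L_def second_quotient_def
      by (intro borel_measurable_lim_metric borel_measurable_divide borel_measurable_diff borel_measurable_add
          borel_measurable_times borel_measurable_const) simp_all
  qed
  define t where "t m e = e * pmf p m / (1 - e)" for m e
  define \<nu> where "\<nu> m = distr unif borel (L m)" for m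
  have \<nu>: "prob_space (\<nu> m)" for m
    unfolding \<nu>_def by (rule prob_space.prob_space_distr[OF prob_space_unif]) simp
  \<comment> \<open>The weights \<open>e\<close> for which cancellation along the
    \<open>m\<close>-th rotation would have positive probability: \<open>t m e\<close> is then an
    atom of the law of \<open>L m\<close>.\<close>
  define Bad where "Bad m = {e \<in> {0<..<1}. measure (\<nu> m) {t m e} \<noteq> 0}" for m
  have "countable (Bad m)" for m
  proof -
    interpret prob_space "\<nu> m" by (rule \<nu>)
    have "t m ` Bad m \<subseteq> {x. measure (\<nu> m) {x} \<noteq> 0}" by (auto simp: Bad_def)
    then have "countable (t m ` Bad m)" by (rule countable_subset[OF _ countable_support])
    moreover have "inj_on (t m) (Bad m)"
    proof (rule inj_onI)
      fix e e' assume "e \<in> Bad m" "e' \<in> Bad m" "t m e = t m e'"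
      then have "e * pmf p m * (1 - e') = e' * pmf p m * (1 - e)"
        by (auto simp: Bad_def t_def frac_eq_eq)
      then have "pmf p m * (e - e') = 0" by (simp add: algebra_simps)
      then show "e = e'" using w[of m] by simp
    qed
    ultimately show ?thesis by (rule countable_image_inj_on)
  qed
  then have "countable (\<Union>m. Bad m)" by simp
  moreover have "uncountable {0<..<d}" using d by (simp add: uncountable_open_interval)
  ultimately obtain e where e: "0 < e" "e < d" "e \<notin> (\<Union>m. Bad m)"
    by (metis (no_types, lifting) countable_subset greaterThanLessThan_iff subsetI)
  then have e1: "e < 1" using d by simp
  \<comment> \<open>A two-point mixture realises the convex combination as a law, so it is again a
    copula.\<close>
  define MB where "MB = mixture (bernoulli_pmf e) (\<lambda>b. if b then MC else MA)"
  have MB: "copula_law MB" unfolding MB_def by (rule copula_law_mixture) (auto simp: MA MC)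
  have cdf_MB: "cdf2 MB z = (1 - e) * cdf2 MA z + e * cdf2 MC z" for z
    unfolding MB_def using e e1 MA(1) MC by (subst cdf2_mixture) (auto simp: algebra_simps)
  define B where "B = restrict (cdf2 MB) unit_sq"
  define C where "C = restrict (cdf2 MC) unit_sq"
  \<comment> \<open>Besides cancellations, this removes the endpoints and the countably many break
    points \<open>1 - r m\<close>, as the limits for the rotations require.\<close>
  define \<Lambda> where "\<Lambda> = {x \<in> {0<..<1}. \<forall>m. x \<noteq> 1 - r m \<and> L m x \<noteq> t m e}"
  have [measurable]: "\<Lambda> \<in> sets borel" unfolding \<Lambda>_def by measurable
  have "AE x in unif. x \<in> \<Lambda>"
  proof -
    have point: "AE x in unif. x \<noteq> c" for c
      by (rule AE_uniform_measureI) (use AE_lborel_singleton[of c] in \<open>auto elim: eventually_mono\<close>)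
    have "AE x in unif. L m x \<noteq> t m e" for m
    proof -
      interpret prob_space "\<nu> m" by (rule \<nu>)
      have "measure (\<nu> m) {t m e} = 0" using e e1 by (auto simp: Bad_def)
      then have "emeasure (\<nu> m) {t m e} = 0" by (simp add: emeasure_eq_measure)
      then have "AE u in \<nu> m. u \<noteq> t m e" by (subst AE_iff_measurable[where N="{t m e}"]) (auto simp: \<nu>_def)
      then show ?thesis unfolding \<nu>_def by (subst (asm) AE_distr_iff) auto
    qed
    then have "AE x in unif. \<forall>m. x \<noteq> 1 - r m \<and> L m x \<noteq> t m e"
      using point by (auto simp: AE_all_countable)
    moreover have "AE x in unif. x \<in> unit_ivl" by (rule AE_uniform_measureI) auto
    ultimately show ?thesis using point[of 0] point[of 1] by eventually_elim (auto simp: \<Lambda>_def)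
  qed
  then have "emeasure unif \<Lambda> = 1" using prob_space.emeasure_eq_1_AE[OF prob_space_unif, of \<Lambda>] by simp
  then have \<Lambda>1: "emeasure lborel \<Lambda> = 1"
    by (subst (asm) emeasure_unif) (auto simp: \<Lambda>_def Int_absorb1 subset_eq)
  have nondiff: "\<not> has_partial1 B x (rot (r m) x)" if x: "x \<in> \<Lambda>" for x m
  proof
    let ?y = "rot (r m) x"
    let ?q = "\<lambda>M k. second_quotient (\<lambda>t. cdf2 M (t, ?y)) x (1 / Suc k)"
    assume "has_partial1 B x ?y"
    moreover have x01: "0 < x" "x < 1" and x_r: "\<And>n. x \<noteq> 1 - r n" and Lx: "L m x \<noteq> t m e"
      using x by (auto simp: \<Lambda>_def)
    moreover have "?y \<in> unit_ivl" using x01 r_in[of m] by (auto simp: rot_def)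
    ultimately have "(\<lambda>k. ?q MB k) \<longlonglongrightarrow> 0"
      unfolding B_def by (intro has_partial1_second_quotient)
    moreover have "(\<lambda>k. ?q MC k) \<longlonglongrightarrow> - pmf p m"
      unfolding MC_def by (rule mixture_rot_law_second_quotient[OF r_in r_inj x01 x_r])
    ultimately have "(\<lambda>k. (?q MB k - e * ?q MC k) / (1 - e)) \<longlonglongrightarrow> (0 - e * (- pmf p m)) / (1 - e)"
      using e1 by (intro tendsto_intros) auto
    moreover have "(?q MB k - e * ?q MC k) / (1 - e) = ?q MA k" for k
    proof -
      have "?q MB k = (1 - e) * ?q MA k + e * ?q MC k"
        by (simp only: cdf_MB second_quotient_linear)
      then show ?thesis using e1 by simp
    qed
    ultimately have "(\<lambda>k. ?q MA k) \<longlonglongrightarrow> t m e" by (simp add: t_def)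
    then show False using Lx limI unfolding L_def by blast
  qed
  have "B \<in> copulas_Q"
    unfolding copulas_Q_def
  proof (intro CollectI conjI bexI[of _ \<Lambda>] ballI)
    show "B \<in> copulas" using MB by (auto simp: copulas_eq B_def)
    fix x assume x: "x \<in> \<Lambda>"
    then have x01: "0 < x" "x < 1" by (auto simp: \<Lambda>_def)
    have "range (\<lambda>m. rot (r m) x) = (\<lambda>q. rot q x) ` (\<rat> \<inter> {0..<1})"
      by (simp only: R_def[symmetric] r_range[symmetric] image_image)
    then have "unit_ivl \<subseteq> closure (range (\<lambda>m. rot (r m) x))" using rot_dense[OF x01] by simp
    moreover have "range (\<lambda>m. rot (r m) x) \<subseteq> unit_ivl"
    proof safe
      fix m show "rot (r m) x \<in> unit_ivl" using x01 r_in[of m] by (auto simp: rot_def)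
    qed
    ultimately show "\<exists>Q\<subseteq>unit_ivl. unit_ivl \<subseteq> closure Q \<and> (\<forall>y\<in>Q. \<not> has_partial1 B x y)"
      using nondiff[OF x] by (intro exI[of _ "range (\<lambda>m. rot (r m) x)"]) auto
  next
    show "\<Lambda> \<subseteq> unit_ivl" by (auto simp: \<Lambda>_def)
  qed (fact \<Lambda>1, measurable)
  moreover have "C \<in> copulas" using MC by (auto simp: copulas_eq C_def)
  moreover have "B z = (1 - e) * A z + e * C z" if "z \<in> unit_sq" for z
    using that by (simp add: B_def C_def MA(2) cdf_MB)
  ultimately show thesis using e(1,2) by (intro that[of B C e])
qed

theorem theorem3p3:
  fixes p :: ennreal
  assumes "1 \<le> p"
  shows "Metric_space copulas (D p) \<and>
         Metric_space.mtopology copulas (D p) closure_of copulas_Q = copulas"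
proof
  show "Metric_space copulas (D p)" by (rule Metric_space_D[OF assms])
  then interpret Metric_space copulas "D p" .
  show "mtopology closure_of copulas_Q = copulas"
  proof (unfold metric_closure_of, safe)
    fix A and s :: real assume A: "A \<in> copulas" and s: "s > 0"
    \<comment> \<open>The cap at 1 keeps \<open>e\<close> a convex weight when the ball has a large
      radius.\<close>
    obtain B C e where B: "B \<in> copulas_Q" "C \<in> copulas" "0 < e" "e < min s 1"
      and eq: "\<And>z. z \<in> unit_sq \<Longrightarrow> B z = (1 - e) * A z + e * C z"
      using copulas_Q_approx[OF A, of "min s 1"] s by auto
    have Bc: "B \<in> copulas" using B by (simp add: copulas_Q_def)
    have "D p A B \<le> e" using B by (intro D_convex_combination_le[OF A B(2) Bc _ _ eq assms]) auto
    then show "\<exists>B\<in>copulas_Q. B \<in> mball A s" using A B Bc by (intro bexI[of _ B]) (auto simp: in_mball)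
  qed
qed

end
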